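(* For $j=1,2$, let $D_j\subset\mathbb{C}$ be bounded domains with $C^1$ boundary. Let $1\le p<\infty$ and let $f=f_1\,d\bar z_1+f_2\,d\bar z_2$ be a $(0,1)$-form that is $\bar\partial$-closed in the weak sense on $D_1\times D_2$. Assume that $f\in\mathcal{B}$, i.e. $f_1,f_2\in L^p(D_1\times D_2)$ and $\mathscr{D}f\in L^p(D_1\times D_2)$. Then $u=Tf$, where $$ \begin{aligned} T(f)(z_1,z_2) &=\frac{-1}{2 \pi i}\int_{D_2}\frac{f_2(z_1,\zeta_2)}{\zeta_2-z_2}\,d\bar \zeta_2\wedge d\zeta_2+\frac{-1}{2 \pi i}\int_{D_1}\frac{f_1(\zeta_1,z_2)}{\zeta_1-z_1}\,d\bar \zeta_1\wedge d\zeta_1\\ &\quad+\frac{-1}{(2 \pi i)^2}\int_{D_1 \times D_2}\frac{(\mathscr{D}f)(\zeta_1,\zeta_2)}{(\zeta_1-z_1)(\zeta_2-z_2)}\,d\bar \zeta_1\wedge d\zeta_1\wedge d\bar \zeta_2\wedge d\zeta_2, \end{aligned} $$ is a weak solution to the equation $\bar\partial u=f$ on $D_1\times D_2$ and satisfies the estimate $$ \|T(f)\|_{L^p(D_1\times D_2)}\le C \|f\|_{\mathcal{B}} $$ for a constant $C>0$ independent of $f$.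
   Context: For a $(0,1)$-form $f=f_1\,d\bar z_1+f_2\,d\bar z_2$, set $\mathscr{D} f= \frac 12\left( \frac{\partial f_1}{\partial\bar z_2} + \frac{\partial f_2}{\partial\bar z_1}\right)$, derivatives in the distributional sense. For $1\le p<\infty$, $\mathcal{B}$ is the Banach space of $(0,1)$-forms on $D_1\times D_2$ with $f_1,f_2,\mathscr{D}f\in L^p(D_1\times D_2)$, normed by $\|f\|_{\mathcal{B}}=\|f_1\|_{L^p(D_1\times D_2)}+\|f_2\|_{L^p(D_1\times D_2)}+\|\mathscr{D}f\|_{L^p(D_1\times D_2)}$. Weakly $\bar\partial$-closed means $\frac{\partial f_1}{\partial\bar z_2}=\frac{\partial f_2}{\partial\bar z_1}$ as distributions; a weak solution of $\bar\partial u=f$ satisfies $\frac{\partial u}{\partial\bar z_j}=f_j$ as distributions, $j=1,2$. In one complex variable $d\bar\zeta\wedge d\zeta = 2i\,dA(\zeta)$, with $dA$ Lebesgue measure on $\mathbb{C}$. *)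

theory Defs
  imports "HOL-Analysis.Analysis"
begin

section \<open>Bounded domains with $C^1$ boundary\<close>

text \<open>Near each boundary point the domain is \<open>{\<rho> < 0}\<close> for a real \<open>C\<^sup>1\<close> function \<open>\<rho>\<close> with
  non-vanishing gradient; \<open>\<complex>\<close> is identified with the Euclidean plane.\<close>

definition C1_boundary :: "complex set \<Rightarrow> bool" where
  "C1_boundary D \<longleftrightarrow>
     (\<forall>b \<in> frontier D. \<exists>U (\<rho> :: complex \<Rightarrow> real) (G :: complex \<Rightarrow> complex).
        open U \<and> b \<in> U \<and> continuous_on U G \<and>
        (\<forall>z \<in> U. GDERIV \<rho> z :> G z \<and> G z \<noteq> 0) \<and>
        D \<inter> U = {z \<in> U. \<rho> z < 0})"

definition bounded_C1_domain :: "complex set \<Rightarrow> bool" where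
  "bounded_C1_domain D \<longleftrightarrow>
     open D \<and> connected D \<and> D \<noteq> {} \<and> bounded D \<and> C1_boundary D"

section \<open>Lebesgue spaces\<close>

definition Lp :: "'a::euclidean_space set \<Rightarrow> real \<Rightarrow> ('a \<Rightarrow> complex) set" where
  "Lp S p = {f. set_borel_measurable lebesgue S f \<and>
                set_integrable lebesgue S (\<lambda>x. norm (f x) powr p)}"

definition Lp_norm :: "'a::euclidean_space set \<Rightarrow> real \<Rightarrow> ('a \<Rightarrow> complex) \<Rightarrow> real" where
  "Lp_norm S p f = (LINT x:S|lebesgue. norm (f x) powr p) powr (1 / p)"

section \<open>Test functions and distributions\<close>

primrec Ck :: "nat \<Rightarrow> ('a::euclidean_space \<Rightarrow> complex) \<Rightarrow> bool" where
  "Ck 0 f \<longleftrightarrow> continuous_on UNIV f"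
| "Ck (Suc k) f \<longleftrightarrow> (\<forall>x. f differentiable (at x)) \<and>
                    (\<forall>v. Ck k (\<lambda>x. frechet_derivative f (at x) v))"

definition test_functions :: "'a::euclidean_space set \<Rightarrow> ('a \<Rightarrow> complex) set" where
  "test_functions \<Omega> = {\<phi>. (\<forall>k. Ck k \<phi>) \<and>
     compact (closure {x. \<phi> x \<noteq> 0}) \<and> closure {x. \<phi> x \<noteq> 0} \<subseteq> \<Omega>}"

type_synonym C2 = "complex \<times> complex"

text \<open>Distributions on \<open>\<Omega>\<close> are represented by functionals of which only the values on
  \<open>test_functions \<Omega>\<close> matter.\<close>

type_synonym dist2 = "(C2 \<Rightarrow> complex) \<Rightarrow> complex"

definition dist_eq :: "C2 set \<Rightarrow> dist2 \<Rightarrow> dist2 \<Rightarrow> bool" where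
  "dist_eq \<Omega> S R \<longleftrightarrow> (\<forall>\<phi> \<in> test_functions \<Omega>. S \<phi> = R \<phi>)"

text \<open>The distribution of a function; meaningful for locally integrable \<open>f\<close> only.\<close>

definition regular_dist :: "C2 set \<Rightarrow> (C2 \<Rightarrow> complex) \<Rightarrow> dist2" where
  "regular_dist \<Omega> f = (\<lambda>\<phi>. LINT z:\<Omega>|lebesgue. f z * \<phi> z)"

text \<open>$\partial/\partial\bar z_j = (\partial/\partial x_j + i\,\partial/\partial y_j)/2$\<close>

definition dbar1 :: "(C2 \<Rightarrow> complex) \<Rightarrow> C2 \<Rightarrow> complex" where
  "dbar1 \<phi> z = (frechet_derivative \<phi> (at z) (1, 0)
                 + \<i> * frechet_derivative \<phi> (at z) (\<i>, 0)) / 2"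

definition dbar2 :: "(C2 \<Rightarrow> complex) \<Rightarrow> C2 \<Rightarrow> complex" where
  "dbar2 \<phi> z = (frechet_derivative \<phi> (at z) (0, 1)
                 + \<i> * frechet_derivative \<phi> (at z) (0, \<i>)) / 2"

definition dist_dbar1 :: "dist2 \<Rightarrow> dist2" where
  "dist_dbar1 S = (\<lambda>\<phi>. - S (dbar1 \<phi>))"

definition dist_dbar2 :: "dist2 \<Rightarrow> dist2" where
  "dist_dbar2 S = (\<lambda>\<phi>. - S (dbar2 \<phi>))"

section \<open>(0,1)-forms and the space \<open>\<B>\<close>\<close>

text \<open>\<open>(f\<^sub>1, f\<^sub>2)\<close> stands for the form with coefficients \<open>f\<^sub>1\<close> and \<open>f\<^sub>2\<close>.\<close>

type_synonym form01 = "(C2 \<Rightarrow> complex) \<times> (C2 \<Rightarrow> complex)"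

definition weakly_dbar_closed :: "C2 set \<Rightarrow> form01 \<Rightarrow> bool" where
  "weakly_dbar_closed \<Omega> f \<longleftrightarrow>
     dist_eq \<Omega> (dist_dbar2 (regular_dist \<Omega> (fst f))) (dist_dbar1 (regular_dist \<Omega> (snd f)))"

definition weak_dbar_solution :: "C2 set \<Rightarrow> form01 \<Rightarrow> (C2 \<Rightarrow> complex) \<Rightarrow> bool" where
  "weak_dbar_solution \<Omega> f u \<longleftrightarrow>
     dist_eq \<Omega> (dist_dbar1 (regular_dist \<Omega> u)) (regular_dist \<Omega> (fst f)) \<and>
     dist_eq \<Omega> (dist_dbar2 (regular_dist \<Omega> u)) (regular_dist \<Omega> (snd f))"

definition DD :: "C2 set \<Rightarrow> form01 \<Rightarrow> dist2" where
  "DD \<Omega> f = (\<lambda>\<phi>. (1 / 2) * (dist_dbar2 (regular_dist \<Omega> (fst f)) \<phi>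
                            + dist_dbar1 (regular_dist \<Omega> (snd f)) \<phi>))"

text \<open>\<open>g\<close> is an \<open>L\<^sup>p\<close> function representing the distribution \<open>DD \<Omega> f\<close>. Such a \<open>g\<close> is unique
  only almost everywhere; the norm of \<open>\<B>\<close> and the operator \<open>T\<close> below take it as an argument.\<close>

definition represents_DD :: "C2 set \<Rightarrow> real \<Rightarrow> form01 \<Rightarrow> (C2 \<Rightarrow> complex) \<Rightarrow> bool" where
  "represents_DD \<Omega> p f g \<longleftrightarrow> g \<in> Lp \<Omega> p \<and> dist_eq \<Omega> (DD \<Omega> f) (regular_dist \<Omega> g)"

definition B_space :: "C2 set \<Rightarrow> real \<Rightarrow> form01 set" where
  "B_space \<Omega> p = {f. fst f \<in> Lp \<Omega> p \<and> snd f \<in> Lp \<Omega> p \<and> (\<exists>g. represents_DD \<Omega> p f g)}"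

definition B_norm :: "C2 set \<Rightarrow> real \<Rightarrow> form01 \<Rightarrow> (C2 \<Rightarrow> complex) \<Rightarrow> real" where
  "B_norm \<Omega> p f g = Lp_norm \<Omega> p (fst f) + Lp_norm \<Omega> p (snd f) + Lp_norm \<Omega> p g"

section \<open>The solution operator\<close>

text \<open>Each factor \<open>2 * \<i>\<close> comes from $d\bar\zeta \wedge d\zeta = 2i\, dA(\zeta)$.\<close>

definition T :: "complex set \<Rightarrow> complex set \<Rightarrow> form01 \<Rightarrow> (C2 \<Rightarrow> complex) \<Rightarrow> C2 \<Rightarrow> complex" where
  "T D1 D2 f g = (\<lambda>(z1, z2).
       (- 1 / (2 * of_real pi * \<i>)) *
         (2 * \<i> * (LINT w2:D2|lebesgue. snd f (z1, w2) / (w2 - z2)))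
     + (- 1 / (2 * of_real pi * \<i>)) *
         (2 * \<i> * (LINT w1:D1|lebesgue. fst f (w1, z2) / (w1 - z1)))
     + (- 1 / (2 * of_real pi * \<i>)\<^sup>2) *
         ((2 * \<i>)\<^sup>2 * (LINT w:(D1 \<times> D2)|lebesgue.
             g w / ((fst w - z1) * (snd w - z2)))))"

text \<open>The integrals defining \<open>T\<close> at a point converge absolutely, so that none of them is
  given the default value of a divergent Bochner integral.\<close>

definition T_converges_at ::
  "complex set \<Rightarrow> complex set \<Rightarrow> form01 \<Rightarrow> (C2 \<Rightarrow> complex) \<Rightarrow> C2 \<Rightarrow> bool" where
  "T_converges_at D1 D2 f g = (\<lambda>(z1, z2).
     set_integrable lebesgue D2 (\<lambda>w2. snd f (z1, w2) / (w2 - z2)) \<and>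
     set_integrable lebesgue D1 (\<lambda>w1. fst f (w1, z2) / (w1 - z1)) \<and>
     set_integrable lebesgue (D1 \<times> D2) (\<lambda>w. g w / ((fst w - z1) * (snd w - z2))))"

end

(* Write k(z) = 1/z cut off at a radius exceeding the diameters of both domains, and let K1, K2 be
   convolution with k in the first and second variable. On D1 x D2, T f is
   -(1/pi) (K2 f2 + K1 f1) - (1/pi^2) K1 K2 (D f). Since k is integrable, Young's inequality (proved
   from the tangent line inequality for x^p) gives the L^p bound and the convergence of the integrals
   almost everywhere.
   To compute dbar_1 (T f) against a test function phi, move the convolutions onto phi. The
   Cauchy-Pompeiu formula for compactly supported functions turns the transpose of K1 applied to
   dbar_1 phi into pi phi, so the K1 f1 term yields f1. In the K2 f2 term the function K2^t phi is
   smooth, but its support is compact in the first variable only; this suffices, because a cut-off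
   in z2 commutes with dbar_1. Hence dbar_1 f2 = D f may be tested on it, and the K2 f2 term cancels
   the K1 K2 (D f) term. The second equation follows by exchanging the variables. *)

theory Submission
  imports Defs "HOL-Real_Asymp.Real_Asymp"
begin

section \<open>Convolution along a map\<close>

text \<open>Cutting off 1/z makes the kernel integrable on the whole plane, so every operator
  becomes a convolution on all of space and no boundary terms arise; the cut-off stays invisible
  because the difference of two points of one domain is shorter than R. The second obstacle is
  measurability. The data are Lebesgue measurable and matter only up to null sets, while Fubini and
  translations act on Borel functions. The data are therefore replaced by Borel functions that
  vanish off the product. A null set has null slices only through almost every point, and so
  \<open>T\<close> is identified with the potential almost everywhere. Boundedness puts L^p inside
  L^1, so the weak equations are proved for integrable data. Closedness enters once: D f is the
  average of two equal derivatives, hence equals each of them. Test functions are smooth of every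
  order, so the cut-offs in one variable are built from exp (-1/x). The constant pi of the
  Cauchy-Pompeiu formula is the integral of 1/(1 + |z|^2)^2 over the plane, found from the areas of
  discs.\<close>

lemma lborel_translate_eq: "distr lborel borel (\<lambda>x. x + c) = (lborel :: 'a::euclidean_space measure)"
  using lborel_distr_plus[of c] by (simp add: add.commute[of _ c])

lemma nn_integral_lborel_translate:
  fixes f :: "'a::euclidean_space \<Rightarrow> ennreal"
  assumes [measurable]: "f \<in> borel_measurable borel"
  shows "(\<integral>\<^sup>+x. f (x + c) \<partial>lborel) = (\<integral>\<^sup>+x. f x \<partial>lborel)"
  by (subst (2) lborel_translate_eq[of c, symmetric]) (simp add: nn_integral_distr)

lemma integral_lborel_translate:
  fixes f :: "'a::euclidean_space \<Rightarrow> 'b::{banach, second_countable_topology}"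
  assumes [measurable]: "f \<in> borel_measurable borel"
  shows "(\<integral>x. f (x + c) \<partial>lborel) = (\<integral>x. f x \<partial>lborel)"
  by (subst (2) lborel_translate_eq[of c, symmetric]) (simp add: integral_distr)

lemma integrable_lborel_translate:
  fixes f :: "'a::euclidean_space \<Rightarrow> 'b::{banach, second_countable_topology}"
  assumes "integrable lborel f"
  shows "integrable lborel (\<lambda>x. f (x + c))"
proof -
  have [measurable]: "f \<in> borel_measurable borel" using assms by auto
  show ?thesis
    using assms by (subst (asm) lborel_translate_eq[of c, symmetric]) (simp add: integrable_distr_eq)
qed

text \<open>With \<open>L\<close> the embedding of the first or second factor, or the identity, this
  is K1, K2 or K1 K2, so one set of lemmas serves all three. The sum \<open>z + L t\<close> matches
  the kernel 1/(w - z) of \<open>T\<close> under w = z + L t; transposition replaces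
  \<open>L\<close> by \<open>- L\<close>.\<close>

definition tconv :: "('b::euclidean_space \<Rightarrow> complex) \<Rightarrow> ('b \<Rightarrow> 'a::euclidean_space) \<Rightarrow>
    ('a \<Rightarrow> complex) \<Rightarrow> 'a \<Rightarrow> complex" where
  "tconv k L F z = (LINT t|lborel. F (z + L t) * k t)"

text \<open>Tonelli puts the integral over \<open>z\<close> inside; for fixed \<open>t\<close> it is
  translation invariant, so the shift \<open>L t\<close> disappears whatever \<open>L\<close>
  is.\<close>

lemma nn_integral_tconv:
  fixes F :: "'a::euclidean_space \<Rightarrow> ennreal" and k :: "'b::euclidean_space \<Rightarrow> ennreal"
  assumes [measurable]: "F \<in> borel_measurable borel" "k \<in> borel_measurable borel" "L \<in> borel_measurable borel"
  shows "(\<integral>\<^sup>+z. \<integral>\<^sup>+t. F (z + L t) * k t \<partial>lborel \<partial>lborel) = (\<integral>\<^sup>+z. F z \<partial>lborel) * (\<integral>\<^sup>+t. k t \<partial>lborel)"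
proof -
  have "(\<integral>\<^sup>+z. \<integral>\<^sup>+t. F (z + L t) * k t \<partial>lborel \<partial>lborel) = (\<integral>\<^sup>+t. \<integral>\<^sup>+z. F (z + L t) * k t \<partial>lborel \<partial>lborel)"
    by (rule lborel_pair.Fubini'[symmetric]) measurable
  also have "\<dots> = (\<integral>\<^sup>+t. (\<integral>\<^sup>+z. F z \<partial>lborel) * k t \<partial>lborel)"
    by (simp add: nn_integral_multc nn_integral_lborel_translate)
  also have "\<dots> = (\<integral>\<^sup>+z. F z \<partial>lborel) * (\<integral>\<^sup>+t. k t \<partial>lborel)"
    by (simp add: nn_integral_cmult)
  finally show ?thesis .
qed

text \<open>This licenses the Fubini exchanges below. The value type is general because it is
  applied to complex data and also to the real functions |F|^p and |k|.\<close>

lemma integrable_pair_tconv: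
  fixes F :: "'a::euclidean_space \<Rightarrow> 'c::{real_normed_algebra, banach, second_countable_topology}"
    and k :: "'b::euclidean_space \<Rightarrow> 'c"
  assumes F: "integrable lborel F" and k: "integrable lborel k" and L[measurable]: "L \<in> borel_measurable borel"
  shows "integrable (lborel \<Otimes>\<^sub>M lborel) (\<lambda>(z, t). F (z + L t) * k t)"
proof -
  have [measurable]: "F \<in> borel_measurable borel" "k \<in> borel_measurable borel" using F k by auto
  show ?thesis
  proof (rule integrableI_bounded)
    show "(\<lambda>(z, t). F (z + L t) * k t) \<in> borel_measurable (lborel \<Otimes>\<^sub>M lborel)" by measurable
    have "(\<integral>\<^sup>+ x. norm (case x of (z, t) \<Rightarrow> F (z + L t) * k t) \<partial>(lborel \<Otimes>\<^sub>M lborel))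
      \<le> (\<integral>\<^sup>+ x. (case x of (z, t) \<Rightarrow> ennreal (norm (F (z + L t))) * ennreal (norm (k t))) \<partial>(lborel \<Otimes>\<^sub>M lborel))"
      by (intro nn_integral_mono)
        (auto simp: ennreal_mult[symmetric] intro!: ennreal_leI norm_mult_ineq)
    also have "\<dots> = (\<integral>\<^sup>+z. \<integral>\<^sup>+t. ennreal (norm (F (z + L t))) * ennreal (norm (k t)) \<partial>lborel \<partial>lborel)"
      by (subst lborel.nn_integral_fst[symmetric]) simp_all
    also have "\<dots> = (\<integral>\<^sup>+z. norm (F z) \<partial>lborel) * (\<integral>\<^sup>+t. norm (k t) \<partial>lborel)"
      by (rule nn_integral_tconv[of "\<lambda>z. ennreal (norm (F z))" "\<lambda>t. ennreal (norm (k t))" L]) auto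
    also have "\<dots> < \<infinity>"
      using F k by (auto simp: integrable_iff_bounded ennreal_mult_less_top)
    finally show "(\<integral>\<^sup>+ x. norm (case x of (z, t) \<Rightarrow> F (z + L t) * k t) \<partial>(lborel \<Otimes>\<^sub>M lborel)) < \<infinity>" .
  qed
qed

lemma integrable_tensor:
  fixes F :: "'a::euclidean_space \<Rightarrow> complex" and k :: "'b::euclidean_space \<Rightarrow> complex"
  assumes "integrable lborel F" "integrable lborel k"
  shows "integrable (lborel \<Otimes>\<^sub>M lborel) (\<lambda>(z, t). F z * k t)"
  using integrable_pair_tconv[OF assms, of "\<lambda>_. 0"] by simp

lemma AE_integrable_tconv:
  fixes F :: "'a::euclidean_space \<Rightarrow> 'c::{real_normed_algebra, banach, second_countable_topology}"
    and k :: "'b::euclidean_space \<Rightarrow> 'c"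
  assumes "integrable lborel F" "integrable lborel k" "L \<in> borel_measurable borel"
  shows "AE z in lborel. integrable lborel (\<lambda>t. F (z + L t) * k t)"
proof -
  show ?thesis using lborel_pair.AE_integrable_fst'[OF integrable_pair_tconv[OF assms]] by simp
qed

lemma integrable_iterated_tconv:
  fixes F :: "'a::euclidean_space \<Rightarrow> 'c::{real_normed_algebra, banach, second_countable_topology}"
    and k :: "'b::euclidean_space \<Rightarrow> 'c"
  assumes "integrable lborel F" "integrable lborel k" "L \<in> borel_measurable borel"
  shows "integrable lborel (\<lambda>z. LINT t|lborel. F (z + L t) * k t)"
proof -
  show ?thesis using lborel_pair.integrable_fst'[OF integrable_pair_tconv[OF assms]] by simp
qed

lemma integrable_tconv:
  assumes "integrable lborel F" "integrable lborel k" "L \<in> borel_measurable borel"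
  shows "integrable lborel (tconv k L F)"
  using integrable_iterated_tconv[OF assms] by (simp add: tconv_def[abs_def])

lemma borel_measurable_tconv [measurable]:
  assumes [measurable]: "F \<in> borel_measurable borel" "k \<in> borel_measurable borel" "L \<in> borel_measurable borel"
  shows "tconv k L F \<in> borel_measurable borel"
  unfolding tconv_def[abs_def] by measurable

lemma integral_iterated_tconv:
  fixes F :: "'a::euclidean_space \<Rightarrow> real" and k :: "'b::euclidean_space \<Rightarrow> real"
  assumes F: "integrable lborel F" and k: "integrable lborel k" and L[measurable]: "L \<in> borel_measurable borel"
  shows "(LINT z|lborel. LINT t|lborel. F (z + L t) * k t) = (LINT z|lborel. F z) * (LINT t|lborel. k t)"
proof -
  have [measurable]: "F \<in> borel_measurable borel" "k \<in> borel_measurable borel" using F k by auto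
  have "(LINT z|lborel. LINT t|lborel. F (z + L t) * k t) = (LINT t|lborel. LINT z|lborel. F (z + L t) * k t)"
    by (rule lborel_pair.Fubini_integral[symmetric]) (rule integrable_pair_tconv[OF assms])
  also have "\<dots> = (LINT t|lborel. (LINT z|lborel. F z) * k t)"
    by (simp add: integral_lborel_translate)
  finally show ?thesis by simp
qed

text \<open>Fubini, the substitution w = z + L t for fixed \<open>t\<close>, and Fubini back.
  Boundedness of \<open>\<psi>\<close> keeps both double integrals absolutely convergent; it is
  later applied with a derivative of a test function as \<open>\<psi>\<close>.\<close>

lemma tconv_transpose:
  fixes F \<psi> :: "'a::euclidean_space \<Rightarrow> complex" and k :: "'b::euclidean_space \<Rightarrow> complex"
  assumes F: "integrable lborel F" and k: "integrable lborel k" and L[measurable]: "L \<in> borel_measurable borel"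
    and \<psi>[measurable]: "\<psi> \<in> borel_measurable borel" and M: "\<And>z. norm (\<psi> z) \<le> M"
  shows "(LINT z|lborel. tconv k L F z * \<psi> z) = (LINT w|lborel. F w * tconv k (\<lambda>t. - L t) \<psi> w)"
proof -
  have [measurable]: "F \<in> borel_measurable borel" "k \<in> borel_measurable borel" using F k by auto
  have M': "norm (\<psi> z) \<le> \<bar>M\<bar>" for z using M[of z] by simp
  have i1: "integrable (lborel \<Otimes>\<^sub>M lborel) (\<lambda>(z, t). F (z + L t) * k t * \<psi> z)"
    by (rule Bochner_Integration.integrable_bound[OF integrable_mult_right[OF integrable_pair_tconv[OF F k L], of "complex_of_real M"]])
      (measurable, auto simp: norm_mult mult.commute[of _ "cmod (\<psi> _)"] intro!: always_eventually mult_right_mono M')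
  have i2: "integrable (lborel \<Otimes>\<^sub>M lborel) (\<lambda>(w, t). F w * k t * \<psi> (w - L t))"
    by (rule Bochner_Integration.integrable_bound[OF integrable_mult_right[OF integrable_tensor[OF F k], of "complex_of_real M"]])
      (measurable, auto simp: norm_mult mult.commute[of _ "cmod (\<psi> _)"] intro!: always_eventually mult_right_mono M')
  have "(LINT z|lborel. tconv k L F z * \<psi> z) = (LINT z|lborel. LINT t|lborel. F (z + L t) * k t * \<psi> z)"
    by (simp add: tconv_def)
  also have "\<dots> = (LINT t|lborel. LINT z|lborel. F (z + L t) * k t * \<psi> z)"
    by (rule lborel_pair.Fubini_integral[symmetric, OF i1])
  also have "\<dots> = (LINT t|lborel. LINT w|lborel. F w * k t * \<psi> (w - L t))"
  proof (rule Bochner_Integration.integral_cong[OF refl])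
    fix t
    show "(LINT z|lborel. F (z + L t) * k t * \<psi> z) = (LINT w|lborel. F w * k t * \<psi> (w - L t))"
      using integral_lborel_translate[of "\<lambda>w. F w * k t * \<psi> (w - L t)" "L t"] by simp
  qed
  also have "\<dots> = (LINT w|lborel. LINT t|lborel. F w * k t * \<psi> (w - L t))"
    by (rule lborel_pair.Fubini_integral[OF i2])
  also have "\<dots> = (LINT w|lborel. F w * tconv k (\<lambda>t. - L t) \<psi> w)"
    unfolding tconv_def by (subst integral_mult_right_zero[symmetric]) (simp add: ac_simps)
  finally show ?thesis .
qed

section \<open>Young's inequality for an integrable kernel\<close>

lemma powr_above_tangent:
  fixes x m p :: real
  assumes "0 \<le> x" "0 < m" "1 \<le> p"
  shows "m powr p + p * m powr (p - 1) * (x - m) \<le> x powr p"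
\<comment> \<open>Convexity is used on the open half-line; at 0 the left side is -(p - 1) m^p by
  direct computation.\<close>
proof (cases "x = 0")
  case True
  have "m powr p = m powr (p - 1) * m" using assms by (simp add: powr_diff)
  then have "m powr p + p * m powr (p - 1) * (x - m) = - ((p - 1) * m powr p)"
    using True by (simp add: algebra_simps)
  then show ?thesis using assms True by simp
next
  case False
  have "p * m powr (p - 1) * (x - m) \<le> x powr p - m powr p"
    using assms False
    by (intro convex_on_imp_above_tangent[OF powr_convex])
      (auto simp: interior_open intro!: derivative_eq_intros)
  then show ?thesis by simp
qed

text \<open>Jensen's inequality for the weight \<open>k\<close>, multiplied out so that a weight of
  mass 0 is covered. The tangent line inequality is taken at the weighted mean of \<open>F\<close>
  and integrated against \<open>k\<close>.\<close>

lemma integral_mult_powr_le: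
  fixes F k :: "'b \<Rightarrow> real"
  assumes p: "1 \<le> p" and F: "\<And>t. 0 \<le> F t" and k: "\<And>t. 0 \<le> k t"
    and k_int: "integrable M k" and Fk_int: "integrable M (\<lambda>t. F t powr p * k t)"
    and [measurable]: "F \<in> borel_measurable M"
  shows "(LINT t|M. F t * k t) powr p \<le> (LINT t|M. k t) powr (p - 1) * (LINT t|M. F t powr p * k t)"
proof -
  have [measurable]: "k \<in> borel_measurable M" using k_int by auto
  define A where "A = (LINT t|M. k t)"
  define I where "I = (LINT t|M. F t * k t)"
  \<comment> \<open>Makes \<open>F t * k t\<close> integrable, being dominated by k + F^p k.\<close>
  have bound: "F t \<le> 1 + F t powr p" for t
  proof (cases "F t \<le> 1")
    case True then show ?thesis by (simp add: add_increasing2)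
  next
    case False
    then have "F t powr 1 \<le> F t powr p" using p by (intro powr_mono) auto
    then show ?thesis using False by simp
  qed
  have int1: "integrable M (\<lambda>t. F t * k t)"
  proof (rule Bochner_Integration.integrable_bound[OF Bochner_Integration.integrable_add[OF k_int Fk_int]])
    have "norm (F t * k t) \<le> norm (k t + F t powr p * k t)" for t
    proof -
      have "F t * k t \<le> (1 + F t powr p) * k t" by (rule mult_right_mono[OF bound k])
      then show ?thesis using F[of t] k[of t] by (simp add: algebra_simps)
    qed
    then show "AE t in M. norm (F t * k t) \<le> norm (k t + F t powr p * k t)" by simp
  qed measurable
  have A0: "0 \<le> A" "0 \<le> I" unfolding A_def I_def using F k by (auto intro!: integral_nonneg_AE)
  show ?thesis
  proof (cases "I = 0")
    case True
    then show ?thesis unfolding A_def[symmetric] I_def[symmetric] using A0 F k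
      by (auto intro!: mult_nonneg_nonneg integral_nonneg_AE)
  next
    case False
    have "A \<noteq> 0"
    proof
      assume "A = 0"
      then have "AE t in M. k t = 0"
        using integral_nonneg_eq_0_iff_AE[OF k_int] k by (auto simp: A_def)
      then have "I = 0" unfolding I_def by (intro integral_eq_zero_AE) auto
      with False show False by simp
    qed
    then have A: "0 < A" and I: "0 < I" using A0 False by auto
    \<comment> \<open>At the weighted mean the linear term of the tangent inequality integrates to
      zero.\<close>
    define m where "m = I / A"
    have m: "0 < m" using A I by (simp add: m_def)
    have "I powr p / A powr (p - 1) = m powr p * A"
      using A I by (simp add: m_def powr_divide powr_diff)
    also have "\<dots> = (LINT t|M. m powr p * k t + p * m powr (p - 1) * (F t * k t - m * k t))"
      using int1 k_int A by (simp add: A_def[symmetric] I_def[symmetric]) (simp add: m_def)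
    also have "\<dots> \<le> (LINT t|M. F t powr p * k t)"
    proof (rule integral_mono)
      fix t
      have "(m powr p + p * m powr (p - 1) * (F t - m)) * k t \<le> F t powr p * k t"
        by (intro mult_right_mono powr_above_tangent F m p k)
      then show "m powr p * k t + p * m powr (p - 1) * (F t * k t - m * k t) \<le> F t powr p * k t"
        by (simp add: algebra_simps)
    qed (use int1 k_int Fk_int in auto)
    finally show ?thesis
      using A by (simp add: A_def[symmetric] I_def[symmetric] field_simps)
  qed
qed

text \<open>Jensen with weight |k| bounds |k * F|^p pointwise by A^(p-1) times the convolution of
  |F|^p with |k|, whose integral is A times that of |F|^p.\<close>

lemma tconv_Lp:
  fixes F :: "'a::euclidean_space \<Rightarrow> complex" and k :: "'b::euclidean_space \<Rightarrow> complex"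
  assumes p: "1 \<le> p" and [measurable]: "F \<in> borel_measurable borel"
    and Fp: "integrable lborel (\<lambda>z. norm (F z) powr p)"
    and k: "integrable lborel k" and L[measurable]: "L \<in> borel_measurable borel"
  defines "A \<equiv> (LINT t|lborel. norm (k t))"
  shows "integrable lborel (\<lambda>z. norm (tconv k L F z) powr p)"
    and "(LINT z|lborel. norm (tconv k L F z) powr p) \<le> A powr p * (LINT z|lborel. norm (F z) powr p)"
proof -
  have [measurable]: "k \<in> borel_measurable borel" using k by auto
  have kn: "integrable lborel (\<lambda>t. norm (k t))" using k by auto
  define R where "R z = A powr (p - 1) * (LINT t|lborel. norm (F (z + L t)) powr p * norm (k t))" for z
  have R_int: "integrable lborel R"
    unfolding R_def[abs_def] by (intro integrable_mult_right integrable_iterated_tconv[OF Fp kn L])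
  have R0: "0 \<le> R z" for z unfolding R_def by (auto intro!: mult_nonneg_nonneg integral_nonneg_AE)
  have le: "AE z in lborel. norm (tconv k L F z) powr p \<le> R z"
    using AE_integrable_tconv[OF Fp kn L]
  proof eventually_elim
    case (elim z)
    have "norm (tconv k L F z) \<le> (LINT t|lborel. norm (F (z + L t)) * norm (k t))"
      unfolding tconv_def norm_mult[symmetric] by (rule integral_norm_bound)
    then have "norm (tconv k L F z) powr p \<le> (LINT t|lborel. norm (F (z + L t)) * norm (k t)) powr p"
      using p by (intro powr_mono2) auto
    also have "\<dots> \<le> R z"
      unfolding R_def A_def using p elim kn by (intro integral_mult_powr_le) auto
    finally show ?case .
  qed
  show int: "integrable lborel (\<lambda>z. norm (tconv k L F z) powr p)"
    by (rule Bochner_Integration.integrable_bound[OF R_int]) (use le R0 in \<open>auto\<close>)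
  have A0: "0 \<le> A" unfolding A_def by auto
  have "(LINT z|lborel. norm (tconv k L F z) powr p) \<le> (LINT z|lborel. R z)"
    by (rule integral_mono_AE[OF int R_int le])
  also have "\<dots> = A powr (p - 1) * (A * (LINT z|lborel. norm (F z) powr p))"
    unfolding R_def integral_mult_right_zero
    by (subst integral_iterated_tconv[OF Fp kn L]) (simp add: A_def mult.commute)
  also have "\<dots> = A powr p * (LINT z|lborel. norm (F z) powr p)"
    using A0 by (cases "A = 0") (auto simp: powr_diff)
  finally show "(LINT z|lborel. norm (tconv k L F z) powr p) \<le> A powr p * (LINT z|lborel. norm (F z) powr p)" .
qed

section \<open>Integrability of the Cauchy kernel\<close>

text \<open>At \<open>z = 0\<close> division by zero gives the value 0. For \<open>z\<close>,
  \<open>w\<close> in a set whose points are less than \<open>R\<close> apart, the value at w - z is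
  1/(w - z).\<close>

definition cauchy_kernel :: "real \<Rightarrow> complex \<Rightarrow> complex" where
  "cauchy_kernel R z = (if norm z < R then 1 / z else 0)"

lemma borel_measurable_cauchy_kernel [measurable]: "cauchy_kernel R \<in> borel_measurable borel"
  unfolding cauchy_kernel_def[abs_def] by measurable

text \<open>A substitute for polar coordinates: after Tonelli the integral over \<open>z\<close> is
  the area of the disc of radius \<open>t\<close>. The factor \<open>indicator {0..} t\<close> is
  essential, since that disc is empty for negative \<open>t\<close> although pi t^2 is
  positive.\<close>

lemma nn_integral_layer_cake_complex:
  fixes w :: "real \<Rightarrow> ennreal"
  assumes [measurable]: "w \<in> borel_measurable borel"
  shows "(\<integral>\<^sup>+z. (\<integral>\<^sup>+t. w t * indicator {norm z<..} t \<partial>lborel) \<partial>(lborel :: complex measure)) =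
    (\<integral>\<^sup>+t. w t * ennreal (pi * t\<^sup>2) * indicator {0..} t \<partial>lborel)"
proof -
  have *: "indicator {norm z<..} t = (indicator {z. norm z < t} z :: ennreal)" for z :: complex and t
    by (auto simp: indicator_def)
  have ball: "{z::complex. norm z < t} = ball 0 t" for t by auto
  have "(\<integral>\<^sup>+z. (\<integral>\<^sup>+t. w t * indicator {norm z<..} t \<partial>lborel) \<partial>(lborel :: complex measure)) =
    (\<integral>\<^sup>+t. (\<integral>\<^sup>+z. w t * indicator {norm z<..} t \<partial>(lborel :: complex measure)) \<partial>lborel)"
    unfolding greaterThan_iff indicator_def by (rule lborel_pair.Fubini'[symmetric]) measurable
  also have "\<dots> = (\<integral>\<^sup>+t. w t * emeasure lborel (ball (0::complex) t) \<partial>lborel)"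
    unfolding * ball by (simp add: nn_integral_cmult_indicator)
  also have "\<dots> = (\<integral>\<^sup>+t. w t * ennreal (pi * t\<^sup>2) * indicator {0..} t \<partial>lborel)"
  proof (intro nn_integral_cong)
    fix t :: real
    show "w t * emeasure lborel (ball (0::complex) t) = w t * ennreal (pi * t\<^sup>2) * indicator {0..} t"
      by (cases "0 \<le> t") (simp_all add: emeasure_ball unit_ball_vol_2 ball_empty)
  qed
  finally show ?thesis .
qed

text \<open>For 0 < s < R, 1/s is 1/R plus the integral of 1/t^2 over [s, R]. The layer formula
  turns the second part into the integral of the constant pi over (0, R], and the first is 1/R times
  the area of a disc.\<close>

lemma integrable_cauchy_kernel: "integrable lborel (cauchy_kernel R)"
proof (cases "0 < R")
  case False
  then have "cauchy_kernel R = (\<lambda>_. 0)"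
    by (auto simp: cauchy_kernel_def fun_eq_iff) (smt (verit) norm_ge_zero)
  then show ?thesis by simp
next
  case R: True
  define w where "w t = ennreal (1 / t\<^sup>2) * indicator {0<..R} t" for t :: real
  have [measurable]: "w \<in> borel_measurable borel" unfolding w_def[abs_def] by measurable
  have inner: "ennreal (norm (cauchy_kernel R z)) \<le>
      (\<integral>\<^sup>+t. w t * indicator {norm z<..} t \<partial>lborel) + ennreal (1 / R) * indicator (ball 0 R) z" for z :: complex
  proof (cases "z = 0 \<or> R \<le> norm z")
    case True then show ?thesis by (auto simp: cauchy_kernel_def)
  next
    case False
    define s where "s = norm z"
    have s: "0 < s" "s < R" using False by (auto simp: s_def)
    have "(\<integral>\<^sup>+t. ennreal (1 / t\<^sup>2) * indicator {s .. R} t \<partial>lborel) = ennreal (- 1 / R - (- 1 / s))"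
      using s by (intro nn_integral_FTC_Icc)
        (auto intro!: derivative_eq_intros simp: has_real_derivative_iff_has_vector_derivative[symmetric] field_simps power2_eq_square)
    \<comment> \<open>The fundamental theorem is applied on the closed interval, while the layers
      use t > s; the two differ in the single point \<open>s\<close>.\<close>
    moreover have "(\<integral>\<^sup>+t. ennreal (1 / t\<^sup>2) * indicator {s .. R} t \<partial>lborel) = (\<integral>\<^sup>+t. w t * indicator {norm z<..} t \<partial>lborel)"
      using AE_lborel_singleton[of s] s
      by (intro nn_integral_cong_AE)
        (auto simp: w_def s_def indicator_def elim!: eventually_mono dest: le_less_trans[OF norm_ge_zero])
    ultimately have "(\<integral>\<^sup>+t. w t * indicator {norm z<..} t \<partial>lborel) = ennreal (1 / s - 1 / R)" by simp
    moreover have "ennreal (1 / s - 1 / R) + ennreal (1 / R) = ennreal (1 / s)"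
      using s by (subst ennreal_plus[symmetric]) (auto simp: field_simps)
    moreover have "ennreal (norm (cauchy_kernel R z)) = ennreal (1 / s)"
      using s by (simp add: cauchy_kernel_def s_def norm_divide)
    ultimately show ?thesis using s by (simp add: s_def)
  qed
  have m: "(\<lambda>z. \<integral>\<^sup>+t. w t * indicator {norm z<..} t \<partial>lborel) \<in> borel_measurable (lborel :: complex measure)"
    unfolding greaterThan_iff indicator_def by measurable
  have m2: "(\<lambda>z. ennreal (1 / R) * indicator (ball 0 R) z) \<in> borel_measurable (lborel :: complex measure)"
    using borel_open[OF open_ball, of "0::complex" R] by measurable
  show ?thesis
  proof (rule integrableI_bounded)
    have "(\<integral>\<^sup>+z. ennreal (norm (cauchy_kernel R z)) \<partial>lborel) \<le>
       (\<integral>\<^sup>+z. (\<integral>\<^sup>+t. w t * indicator {norm z<..} t \<partial>lborel) + ennreal (1 / R) * indicator (ball 0 R) z \<partial>(lborel :: complex measure))"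
      by (intro nn_integral_mono inner)
    also have "\<dots> = (\<integral>\<^sup>+z. (\<integral>\<^sup>+t. w t * indicator {norm z<..} t \<partial>lborel) \<partial>(lborel :: complex measure)) +
       ennreal (1 / R) * emeasure lborel (ball (0::complex) R)"
      unfolding nn_integral_add[OF m m2] by (subst nn_integral_cmult_indicator) simp_all
    also have "\<dots> < \<infinity>"
    proof -
      have "(\<integral>\<^sup>+z. (\<integral>\<^sup>+t. w t * indicator {norm z<..} t \<partial>lborel) \<partial>(lborel :: complex measure)) = 
         (\<integral>\<^sup>+t. w t * ennreal (pi * t\<^sup>2) * indicator {0..} t \<partial>lborel)"
        by (rule nn_integral_layer_cake_complex) simp
      also have "\<dots> \<le> (\<integral>\<^sup>+t. ennreal pi * indicator {0..R} t \<partial>lborel)"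
        by (intro nn_integral_mono) (auto simp: w_def indicator_def ennreal_mult[symmetric])
      also have "\<dots> < \<infinity>" using R by (simp add: nn_integral_cmult ennreal_mult_less_top)
      finally show ?thesis using R by (simp add: ennreal_mult_less_top emeasure_ball)
    qed
    finally show "(\<integral>\<^sup>+z. ennreal (norm (cauchy_kernel R z)) \<partial>lborel) < \<infinity>" .
  qed simp
qed

text \<open>The mass of the approximate identity below. The integrand at |z| = s is the integral of
  4 t / (1 + t^2)^3 over t > s; with disc areas as weights there remains pi times the integral of 4
  t^3 / (1 + t^2)^3, with primitive t^4 / (1 + t^2)^2.\<close>

lemma has_bochner_integral_inverse_one_plus_norm_sq:
  "has_bochner_integral lborel (\<lambda>z::complex. 1 / (1 + (norm z)\<^sup>2)\<^sup>2) pi"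
proof (rule has_bochner_integral_nn_integral)
  define w where "w t = ennreal (4 * t / (1 + t\<^sup>2) ^ 3) * indicator {0..} t" for t :: real
  have [measurable]: "w \<in> borel_measurable borel" unfolding w_def[abs_def] by measurable
  have pos: "1 + x\<^sup>2 \<noteq> 0" "0 < 1 + x\<^sup>2" for x :: real using zero_le_power2[of x] by linarith+
  have inner: "ennreal (1 / (1 + (norm z)\<^sup>2)\<^sup>2) = (\<integral>\<^sup>+t. w t * indicator {norm z<..} t \<partial>lborel)" for z :: complex
  proof -
    define s where "s = norm z"
    have s: "0 \<le> s" by (simp add: s_def)
    have nn: "0 \<le> x" if "norm z < x" for x
      using that norm_ge_zero[of z] by linarith
    have "(\<integral>\<^sup>+t. ennreal (4 * t / (1 + t\<^sup>2) ^ 3) * indicator {s ..} t \<partial>lborel) = ennreal (0 - (- (1 / (1 + s\<^sup>2)\<^sup>2)))"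
    proof (rule nn_integral_FTC_atLeast)
      show "((\<lambda>t::real. - (1 / (1 + t\<^sup>2)\<^sup>2)) \<longlongrightarrow> 0) at_top" by real_asymp
      show "((\<lambda>t::real. - (1 / (1 + t\<^sup>2)\<^sup>2)) has_real_derivative 4 * x / (1 + x\<^sup>2) ^ 3) (at x)" for x
        using pos[of x] by (auto intro!: derivative_eq_intros simp: divide_simps) (simp add: algebra_simps eval_nat_numeral)
    qed (use s pos in \<open>auto intro!: divide_nonneg_pos zero_less_power\<close>)
    moreover have "(\<integral>\<^sup>+t. ennreal (4 * t / (1 + t\<^sup>2) ^ 3) * indicator {s ..} t \<partial>lborel) = (\<integral>\<^sup>+t. w t * indicator {norm z<..} t \<partial>lborel)"
      using AE_lborel_singleton[of s] s
      by (intro nn_integral_cong_AE) (auto simp: w_def s_def indicator_def elim!: eventually_mono dest: nn)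
    ultimately show ?thesis by (simp add: s_def)
  qed
  have "(\<integral>\<^sup>+z. ennreal (1 / (1 + (norm z)\<^sup>2)\<^sup>2) \<partial>(lborel :: complex measure)) = (\<integral>\<^sup>+t. w t * ennreal (pi * t\<^sup>2) * indicator {0..} t \<partial>lborel)"
    unfolding inner by (rule nn_integral_layer_cake_complex) simp
  also have "\<dots> = (\<integral>\<^sup>+t. ennreal (pi * (4 * t ^ 3 / (1 + t\<^sup>2) ^ 3)) * indicator {0..} t \<partial>lborel)"
    using pos by (intro nn_integral_cong)
      (auto simp: w_def indicator_def ennreal_mult[symmetric] power2_eq_square power3_eq_cube algebra_simps)
  also have "\<dots> = ennreal (pi - pi * (0 ^ 4 / (1 + 0\<^sup>2)\<^sup>2))"
  proof (rule nn_integral_FTC_atLeast)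
    show "((\<lambda>t::real. pi * (t ^ 4 / (1 + t\<^sup>2)\<^sup>2)) \<longlongrightarrow> pi) at_top" by real_asymp
    show "((\<lambda>t::real. pi * (t ^ 4 / (1 + t\<^sup>2)\<^sup>2)) has_real_derivative pi * (4 * x ^ 3 / (1 + x\<^sup>2) ^ 3)) (at x)" for x
      using pos[of x] by (auto intro!: derivative_eq_intros simp: divide_simps) (simp add: algebra_simps eval_nat_numeral)
  qed (use pos in \<open>auto intro!: mult_nonneg_nonneg divide_nonneg_pos zero_less_power\<close>)
  finally show "(\<integral>\<^sup>+z. ennreal (1 / (1 + (norm z)\<^sup>2)\<^sup>2) \<partial>(lborel :: complex measure)) = ennreal pi" by simp
qed auto

section \<open>The Cauchy--Pompeiu formula\<close>

lemma integrable_continuous_bounded_support: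
  fixes f :: "'a::euclidean_space \<Rightarrow> 'b::{banach, second_countable_topology}"
  assumes "continuous_on UNIV f" and "\<And>z. B < norm z \<Longrightarrow> f z = 0"
  shows "integrable lborel f"
proof -
  have "integrable lborel (\<lambda>x. indicator (cball 0 B) x *\<^sub>R f x)"
    by (rule borel_integrable_compact) (auto intro: continuous_on_subset[OF assms(1)])
  moreover have "(\<lambda>x. indicator (cball 0 B) x *\<^sub>R f x) = f"
    using assms(2) by (auto simp: fun_eq_iff indicator_def not_le)
  ultimately show ?thesis by simp
qed

lemma bounded_continuous_bounded_support:
  fixes f :: "'a::euclidean_space \<Rightarrow> 'b::real_normed_vector"
  assumes "continuous_on UNIV f" and "\<And>z. B < norm z \<Longrightarrow> f z = 0"
  obtains M where "0 \<le> M" "\<And>z. norm (f z) \<le> M"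
proof -
  have "bounded (f ` cball 0 B)"
    by (intro compact_imp_bounded compact_continuous_image continuous_on_subset[OF assms(1)]) auto
  then obtain M where M: "\<forall>z\<in>cball 0 B. norm (f z) \<le> M"
    unfolding bounded_iff by auto
  have "norm (f z) \<le> max M 0" for z
    using bspec[OF M, of z] assms(2)[of z] by (cases "norm z \<le> B") (auto simp: le_max_iff_disj)
  then show ?thesis using that[of "max M 0"] by auto
qed

lemma has_derivative_zero_outside:
  assumes "(f has_derivative f') (at z)" and "\<And>z. B < norm z \<Longrightarrow> f z = 0" and "B < norm z"
  shows "f' v = 0"
proof -
  have "open {z. B < norm z}" by (intro open_Collect_less continuous_intros)
  then have "(f has_derivative (\<lambda>_. 0)) (at z)"
    using assms(2,3) by (intro has_derivative_transform_within_open[OF has_derivative_const[of 0]]) auto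
  from has_derivative_unique[OF assms(1) this] show ?thesis by simp
qed

lemma has_vector_derivative_along_line:
  assumes "\<And>z. (F has_derivative F' z) (at z)"
  shows "((\<lambda>t. F (z + t *\<^sub>R v)) has_vector_derivative F' (z + t *\<^sub>R v) v) (at t)"
proof -
  have "((\<lambda>t. F (z + t *\<^sub>R v)) has_derivative (\<lambda>s. F' (z + t *\<^sub>R v) (s *\<^sub>R v))) (at t)"
    by (rule has_derivative_compose[OF _ assms]) (auto intro!: derivative_eq_intros)
  moreover have "F' (z + t *\<^sub>R v) (s *\<^sub>R v) = s *\<^sub>R F' (z + t *\<^sub>R v) v" for s
    by (rule linear_scale[OF has_derivative_linear[OF assms]])
  ultimately show ?thesis by (simp add: has_vector_derivative_def)
qed

text \<open>The mean value inequality along a line. It dominates difference quotients uniformly in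
  the base point, as dominated convergence requires.\<close>

lemma directional_increment_bound:
  assumes der: "\<And>z. (F has_derivative F' z) (at z)" and M: "\<And>z. norm (F' z v) \<le> M"
  shows "norm (F (z + h *\<^sub>R v) - F z) \<le> M * \<bar>h\<bar>"
proof -
  have "norm (F (z + h *\<^sub>R v) - F (z + 0 *\<^sub>R v)) \<le> M * norm (h - 0)"
  proof (rule differentiable_bound[of UNIV "\<lambda>t. F (z + t *\<^sub>R v)" "\<lambda>t s. s *\<^sub>R F' (z + t *\<^sub>R v) v"])
    fix t :: real
    show "((\<lambda>t. F (z + t *\<^sub>R v)) has_derivative (\<lambda>s. s *\<^sub>R F' (z + t *\<^sub>R v) v)) (at t within UNIV)"
      using has_vector_derivative_along_line[OF der] by (simp add: has_vector_derivative_def)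
    show "onorm (\<lambda>s. s *\<^sub>R F' (z + t *\<^sub>R v) v) \<le> M"
      by (rule onorm_le) (use M in \<open>auto simp: mult.commute[of M] intro: mult_left_mono\<close>)
  qed auto
  then show ?thesis by simp
qed

lemma directional_derivative_sequence:
  assumes der: "\<And>z. (F has_derivative F' z) (at z)"
  shows "(\<lambda>n. (F (z + inverse (real (Suc n)) *\<^sub>R v) - F z) /\<^sub>R inverse (real (Suc n))) \<longlonglongrightarrow> F' z v"
proof -
  let ?g = "\<lambda>h. F (z + h *\<^sub>R v)" and ?d = "F' z v"
  have "((\<lambda>h. norm ((?g h - ?g 0) /\<^sub>R h - ?d)) \<longlongrightarrow> 0) (at 0)"
  proof (rule Lim_transform_eventually)
    show "((\<lambda>h. norm (?g h - ?g 0 - h *\<^sub>R ?d) / norm h) \<longlongrightarrow> 0) (at 0)"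
      using has_vector_derivative_along_line[OF der, of z v 0]
      by (simp add: has_vector_derivative_def has_derivative_iff_norm)
    have "norm (?g h - ?g 0 - h *\<^sub>R ?d) / norm h = norm ((?g h - ?g 0) /\<^sub>R h - ?d)" if "h \<noteq> 0" for h
    proof -
      have "(?g h - ?g 0) /\<^sub>R h - ?d = (?g h - ?g 0 - h *\<^sub>R ?d) /\<^sub>R h"
        using that by (simp add: scaleR_diff_right)
      then show ?thesis by (simp add: divide_inverse mult.commute)
    qed
    then show "eventually (\<lambda>h. norm (?g h - ?g 0 - h *\<^sub>R ?d) / norm h = norm ((?g h - ?g 0) /\<^sub>R h - ?d)) (at 0)"
      by (auto simp: eventually_at_filter)
  qed
  then have "((\<lambda>h. (F (z + h *\<^sub>R v) - F z) /\<^sub>R h) \<longlongrightarrow> F' z v) (at 0)"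
    using LIM_zero_cancel[OF tendsto_norm_zero_cancel, of "\<lambda>h. (?g h - ?g 0) /\<^sub>R h" ?d] by simp
  moreover have "filterlim (\<lambda>n. inverse (real (Suc n))) (at 0) sequentially"
    by (rule filterlim_atI[OF LIMSEQ_inverse_real_of_nat]) auto
  ultimately show ?thesis by (rule filterlim_compose)
qed

text \<open>Translation invariance makes the integrals of the difference quotients vanish.\<close>

lemma integral_directional_derivative_eq_0:
  fixes F :: "'a::euclidean_space \<Rightarrow> complex"
  assumes der: "\<And>z. (F has_derivative F' z) (at z)"
    and cont: "continuous_on UNIV (\<lambda>z. F' z v)"
    and supp: "\<And>z. B < norm z \<Longrightarrow> F z = 0"
  shows "(LINT z|lborel. F' z v) = 0"
proof -
  have F: "continuous_on UNIV F"
    using der by (auto simp: continuous_on_eq_continuous_at intro: has_derivative_continuous)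
  have supp': "B < norm z \<Longrightarrow> F' z v = 0" for z
    by (rule has_derivative_zero_outside[OF der supp])
  obtain M where M: "0 \<le> M" "\<And>z. norm (F' z v) \<le> M"
    using bounded_continuous_bounded_support[OF cont supp'] by blast
  define s where "s n z = (F (z + inverse (real (Suc n)) *\<^sub>R v) - F z) /\<^sub>R inverse (real (Suc n))" for n z
  have Fint: "integrable lborel F"
    by (rule integrable_continuous_bounded_support[OF F supp])
  have [measurable]: "F \<in> borel_measurable borel" using Fint by auto
  have [measurable]: "(\<lambda>z. F' z v) \<in> borel_measurable borel"
    by (rule borel_measurable_continuous_onI[OF cont])
  have "(\<lambda>n. LINT z|lborel. s n z) \<longlonglongrightarrow> (LINT z|lborel. F' z v)"
  proof (rule integral_dominated_convergence)
    \<comment> \<open>A step of length at most 1 in direction \<open>v\<close> moves the support by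
      at most \<open>norm v\<close>, hence the enlarged ball.\<close>
    show "integrable lborel (\<lambda>z. indicator (cball (0::'a) (B + norm v)) z * M)"
      by (intro integrable_mult_left integrable_real_indicator) (auto simp: emeasure_lborel_cball_finite[unfolded infinity_ennreal_def])
    show "AE z in lborel. norm (s n z) \<le> indicator (cball 0 (B + norm v)) z * M" for n
    proof (rule AE_I2)
      fix z
      define h where "h = inverse (real (Suc n))"
      have h: "0 < h" "h \<le> 1" by (auto simp: h_def field_simps)
      show "norm (s n z) \<le> indicator (cball 0 (B + norm v)) z * M"
      proof (cases "norm z \<le> B + norm v")
        case True
        have "norm (s n z) \<le> (M * \<bar>h\<bar>) / \<bar>h\<bar>"
          unfolding s_def norm_scaleR h_def[symmetric] using directional_increment_bound[OF der M(2), of z h] h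
          by (simp add: field_simps)
        then show ?thesis using True h by simp
      next
        case False
        have "norm (h *\<^sub>R v) \<le> norm v" using h by (simp add: mult_left_le_one_le)
        then have "B < norm (z + h *\<^sub>R v)"
          using False norm_triangle_ineq2[of z "- (h *\<^sub>R v)"] by simp
        moreover have "B < norm z" using False norm_ge_zero[of v] by linarith
        ultimately show ?thesis using M(1) unfolding s_def h_def[symmetric] by (simp add: supp)
      qed
    qed
    show "AE z in lborel. (\<lambda>n. s n z) \<longlonglongrightarrow> F' z v"
      unfolding s_def by (rule AE_I2) (rule directional_derivative_sequence[OF der])
  qed (auto simp: s_def)
  moreover have "(LINT z|lborel. s n z) = 0" for n
    using integrable_lborel_translate[OF Fint] Fint by (simp add: s_def integral_lborel_translate)
  ultimately show ?thesis by (simp add: LIMSEQ_const_iff)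
qed

lemma integral_lborel_scale:
  fixes f :: "'a::euclidean_space \<Rightarrow> complex"
  assumes "0 < c" and [measurable]: "f \<in> borel_measurable borel"
  shows "(LINT x|lborel. f x) = (LINT x|lborel. c ^ DIM('a) *\<^sub>R f (c *\<^sub>R x))"
proof -
  have "(LINT x|lborel. f x) = (LINT x|density (distr lborel borel (\<lambda>x::'a. 0 + c *\<^sub>R x)) (\<lambda>_. ennreal (\<bar>c\<bar> ^ DIM('a))). f x)"
    using assms(1) by (subst lborel_affine[of c 0]) simp_all
  also have "\<dots> = (LINT x|lborel. c ^ DIM('a) *\<^sub>R f (c *\<^sub>R x))"
    using assms(1) by (simp add: integral_density integral_distr)
  finally show ?thesis .
qed

text \<open>The kernel \<open>1 / z\<close> is regularised to \<open>cnj z / (\<bar>z\<bar>\<^sup>2 + d\<^sup>2)\<close>, whose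
  \<open>\<partial>/\<partial>\<bar>z\<close> is \<open>d\<^sup>2 / (\<bar>z\<bar>\<^sup>2 + d\<^sup>2)\<^sup>2\<close>, an approximate identity of mass \<open>pi\<close>.\<close>

lemma Cauchy_Pompeiu_compact_support:
  fixes \<phi> :: "complex \<Rightarrow> complex"
  assumes der: "\<And>z. (\<phi> has_derivative \<phi>' z) (at z)"
    and c1: "continuous_on UNIV (\<lambda>z. \<phi>' z 1)" and ci: "continuous_on UNIV (\<lambda>z. \<phi>' z \<i>)"
    and supp: "\<And>z. B < norm z \<Longrightarrow> \<phi> z = 0"
  shows "(LINT z|lborel. (\<phi>' z 1 + \<i> * \<phi>' z \<i>) / 2 * (1 / z)) = - (pi * \<phi> 0)"
proof -
  define e where "e z = (\<phi>' z 1 + \<i> * \<phi>' z \<i>) / 2" for z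
  define k where "k d z = cnj z / complex_of_real (z \<bullet> z + d\<^sup>2)" for d z
  define q where "q d z = complex_of_real (d\<^sup>2 / (z \<bullet> z + d\<^sup>2)\<^sup>2)" for d and z :: complex
  have \<phi>: "continuous_on UNIV \<phi>"
    using der by (auto simp: continuous_on_eq_continuous_at intro: has_derivative_continuous)
  have supp': "B < norm z \<Longrightarrow> \<phi>' z v = 0" for z v
    by (rule has_derivative_zero_outside[OF der supp])
  have e: "continuous_on UNIV e" unfolding e_def[abs_def] by (intro continuous_intros c1 ci) auto
  have supp_e: "B < norm z \<Longrightarrow> e z = 0" for z by (simp add: e_def supp')
  have pos: "0 < z \<bullet> z + d\<^sup>2" "z \<bullet> z + d\<^sup>2 \<noteq> 0" if "0 < d" for d and z :: complex
  proof -
    show "0 < z \<bullet> z + d\<^sup>2" using that by (intro add_nonneg_pos) auto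
    then show "z \<bullet> z + d\<^sup>2 \<noteq> 0" by simp
  qed
  have k_cont: "continuous_on UNIV (k d)" if "0 < d" for d
    unfolding k_def[abs_def] using pos[OF that] by (intro continuous_intros) (auto simp del: of_real_add)
  have q_cont: "continuous_on UNIV (q d)" if "0 < d" for d
    unfolding q_def[abs_def] using pos[OF that] by (intro continuous_intros) (auto simp del: of_real_add)
  \<comment> \<open>Integration by parts: dbar (phi k_d) = k_d dbar phi + phi q_d, and the left side
    integrates to 0 because both directional derivatives of a function of bounded support
    do.\<close>
  have key: "(LINT z|lborel. e z * k d z) = - (LINT z|lborel. \<phi> z * q d z)" if d: "0 < d" for d
  proof -
    define k' where "k' z v = cnj v / complex_of_real (z \<bullet> z + d\<^sup>2)
        - cnj z * complex_of_real (2 * (z \<bullet> v)) / (complex_of_real (z \<bullet> z + d\<^sup>2))\<^sup>2" for z v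
    have k': "(k d has_derivative k' z) (at z)" for z
      unfolding k_def[abs_def] k'_def using pos[OF d, of z]
      by (auto intro!: derivative_eq_intros simp del: of_real_add
          simp: fun_eq_iff inner_commute divide_simps) (simp add: algebra_simps power2_eq_square)
    define F' where "F' z v = \<phi> z * k' z v + \<phi>' z v * k d z" for z v
    have F': "((\<lambda>z. \<phi> z * k d z) has_derivative F' z) (at z)" for z
      unfolding F'_def by (rule has_derivative_mult[OF der k'])
    have k'_cont: "continuous_on UNIV (\<lambda>z. k' z v)" for v
      unfolding k'_def using pos[OF d] by (intro continuous_intros) (auto simp del: of_real_add)
    have F'_cont: "continuous_on UNIV (\<lambda>z. F' z 1)" "continuous_on UNIV (\<lambda>z. F' z \<i>)"
      unfolding F'_def by (intro continuous_intros \<phi> k'_cont c1 ci k_cont[OF d])+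
    have 0: "(LINT z|lborel. F' z 1) = 0" "(LINT z|lborel. F' z \<i>) = 0"
      by (rule integral_directional_derivative_eq_0[OF F' F'_cont(1), of B]
               integral_directional_derivative_eq_0[OF F' F'_cont(2), of B]; simp add: supp)+
    have "B < norm z \<Longrightarrow> F' z v = 0" for z v by (simp add: F'_def supp supp')
    then have int: "integrable lborel (\<lambda>z. F' z 1)" "integrable lborel (\<lambda>z. F' z \<i>)"
      by (intro integrable_continuous_bounded_support[OF F'_cont(1), of B]
          integrable_continuous_bounded_support[OF F'_cont(2), of B]; simp)+
    \<comment> \<open>Since dbar of \<open>cnj z\<close> is 1 and dbar of |z|^2 is z, the quotient
      rule gives 1/r - |z|^2/r^2 = d^2/r^2 with r = |z|^2 + d^2.\<close>
    have k'q: "(k' z 1 + \<i> * k' z \<i>) / 2 = q d z" for z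
    proof -
      define r where "r = complex_of_real (z \<bullet> z + d\<^sup>2)"
      have r: "r \<noteq> 0" using pos(2)[OF d, of z] unfolding r_def of_real_eq_0_iff .
      have zz: "cnj z * z = complex_of_real (z \<bullet> z)"
        by (metis dot_square_norm of_real_power complex_norm_square mult.commute)
      have "(k' z 1 + \<i> * k' z \<i>) / 2 = 1 / r - cnj z * (Re z + \<i> * Im z) / r\<^sup>2"
        unfolding k'_def r_def[symmetric] using r by (simp add: inner_complex_def field_simps)
      also have "\<dots> = (r - complex_of_real (z \<bullet> z)) / r\<^sup>2"
        using r by (simp add: complex_eq[symmetric] zz diff_divide_distrib power2_eq_square)
      also have "\<dots> = q d z" unfolding q_def r_def by simp
      finally show ?thesis .
    qed
    have "(F' z 1 + \<i> * F' z \<i>) / 2 = e z * k d z + \<phi> z * q d z" for z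
      unfolding F'_def e_def k'q[symmetric] by (simp add: algebra_simps add_divide_distrib)
    then have "(LINT z|lborel. e z * k d z + \<phi> z * q d z) = (LINT z|lborel. (F' z 1 + \<i> * F' z \<i>) / 2)"
      by (simp only:)
    also have "\<dots> = 0" using int 0 by simp
    also have "(LINT z|lborel. e z * k d z + \<phi> z * q d z) = (LINT z|lborel. e z * k d z) + (LINT z|lborel. \<phi> z * q d z)"
      by (intro Bochner_Integration.integral_add integrable_continuous_bounded_support[of _ B] continuous_intros e k_cont \<phi> q_cont d)
        (simp_all add: supp supp_e)
    finally show ?thesis by (simp add: eq_neg_iff_add_eq_0)
  qed
  define d where "d n = inverse (real (Suc n))" for n
  have d: "0 < d n" for n by (simp add: d_def)
  have d0: "d \<longlonglongrightarrow> 0" unfolding d_def by (rule LIMSEQ_inverse_real_of_nat)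
  obtain Me where Me: "0 \<le> Me" "\<And>z. norm (e z) \<le> Me"
    using bounded_continuous_bounded_support[OF e supp_e] by blast
  obtain M where M: "0 \<le> M" "\<And>z. norm (\<phi> z) \<le> M"
    using bounded_continuous_bounded_support[OF \<phi> supp] by blast
  have [measurable]: "e \<in> borel_measurable borel" "\<phi> \<in> borel_measurable borel"
    by (auto intro: borel_measurable_continuous_onI e \<phi>)
  have [measurable]: "k (d n) \<in> borel_measurable borel" "q (d n) \<in> borel_measurable borel" for n
    by (auto intro: borel_measurable_continuous_onI k_cont q_cont d)
  have lim1: "(\<lambda>n. LINT z|lborel. e z * k (d n) z) \<longlonglongrightarrow> (LINT z|lborel. e z * (1 / z))"
  proof (rule integral_dominated_convergence)
    \<comment> \<open>The regularised kernel is at most 1/|z|. The radius \<open>B + 1\<close> keeps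
      the cut-off kernel equal to 1/z on the whole closed ball of radius \<open>B\<close>.\<close>
    show "integrable lborel (\<lambda>z. Me * norm (cauchy_kernel (B + 1) z))"
      using integrable_cauchy_kernel by auto
    show "AE z in lborel. (\<lambda>n. e z * k (d n) z) \<longlonglongrightarrow> e z * (1 / z)"
      using AE_lborel_singleton[of 0]
    proof eventually_elim
      case (elim z)
      have "(\<lambda>n. e z * k (d n) z) \<longlonglongrightarrow> e z * (cnj z / complex_of_real (z \<bullet> z + 0\<^sup>2))"
        unfolding k_def using elim by (intro tendsto_intros d0) auto
      moreover have "cnj z / complex_of_real (z \<bullet> z + 0\<^sup>2) = 1 / z"
        using elim complex_norm_square[of z] by (simp add: dot_square_norm divide_simps mult.commute)
      ultimately show ?case by (simp only:)
    qed
    show "AE z in lborel. norm (e z * k (d n) z) \<le> Me * norm (cauchy_kernel (B + 1) z)" for n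
    proof (rule AE_I2)
      fix z
      show "norm (e z * k (d n) z) \<le> Me * norm (cauchy_kernel (B + 1) z)"
      proof (cases "B < norm z \<or> z = 0")
        case True
        then show ?thesis using Me(1) supp_e[of z] by (auto simp: k_def)
      next
        case False
        have "norm (k (d n) z) = norm z / (norm z * norm z + (d n)\<^sup>2)"
          using pos[OF d, of z n] by (simp add: k_def norm_divide dot_square_norm power2_eq_square del: of_real_add)
        also have "\<dots> \<le> norm z / (norm z * norm z)"
          using False by (intro divide_left_mono) (auto intro!: mult_pos_pos add_pos_nonneg)
        also have "\<dots> = norm (cauchy_kernel (B + 1) z)"
          using False by (simp add: cauchy_kernel_def norm_divide)
        finally show ?thesis unfolding norm_mult by (intro mult_mono Me) auto
      qed
    qed
  qed auto
  \<comment> \<open>Scaling by \<open>d n\<close> turns the approximate identity into one fixed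
    weight and moves the parameter into the argument of \<open>\<phi>\<close>, where continuity at 0
    handles it.\<close>
  have scale: "(LINT z|lborel. \<phi> z * q (d n) z) = (LINT z|lborel. \<phi> (d n *\<^sub>R z) * complex_of_real (1 / (1 + (norm z)\<^sup>2)\<^sup>2))" for n
  proof -
    have "(LINT z|lborel. \<phi> z * q (d n) z) = (LINT z|lborel. (d n)\<^sup>2 *\<^sub>R (\<phi> (d n *\<^sub>R z) * q (d n) (d n *\<^sub>R z)))"
      by (subst integral_lborel_scale[OF d[of n]]) auto
    also have "\<dots> = (LINT z|lborel. \<phi> (d n *\<^sub>R z) * complex_of_real (1 / (1 + (norm z)\<^sup>2)\<^sup>2))"
    proof (rule Bochner_Integration.integral_cong[OF refl])
      fix z :: complex
      have "(d n)\<^sup>2 * ((d n)\<^sup>2 / ((d n *\<^sub>R z) \<bullet> (d n *\<^sub>R z) + (d n)\<^sup>2)\<^sup>2) = 1 / (1 + (norm z)\<^sup>2)\<^sup>2"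
      proof -
        have "(d n *\<^sub>R z) \<bullet> (d n *\<^sub>R z) + (d n)\<^sup>2 = (d n)\<^sup>2 * (1 + (norm z)\<^sup>2)"
          by (simp add: dot_square_norm power2_eq_square algebra_simps)
        then show ?thesis using d[of n] by (simp only: power_mult_distrib) (simp add: power2_eq_square)
      qed
      then have "(d n)\<^sup>2 *\<^sub>R q (d n) (d n *\<^sub>R z) = complex_of_real (1 / (1 + (norm z)\<^sup>2)\<^sup>2)"
        unfolding q_def scaleR_conv_of_real of_real_mult[symmetric] by simp
      then show "(d n)\<^sup>2 *\<^sub>R (\<phi> (d n *\<^sub>R z) * q (d n) (d n *\<^sub>R z)) = \<phi> (d n *\<^sub>R z) * complex_of_real (1 / (1 + (norm z)\<^sup>2)\<^sup>2)"
        by (metis mult_scaleR_right)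
    qed
    finally show ?thesis .
  qed
  have lim2: "(\<lambda>n. LINT z|lborel. \<phi> z * q (d n) z) \<longlonglongrightarrow> (LINT z|lborel. \<phi> 0 * complex_of_real (1 / (1 + (norm (z::complex))\<^sup>2)\<^sup>2))"
    unfolding scale
  proof (rule integral_dominated_convergence)
    show "integrable lborel (\<lambda>z::complex. M * (1 / (1 + (norm z)\<^sup>2)\<^sup>2))"
      using has_bochner_integral_inverse_one_plus_norm_sq
      by (intro integrable_mult_right) (auto simp: has_bochner_integral_iff)
    show "AE z in lborel. (\<lambda>n. \<phi> (d n *\<^sub>R z) * complex_of_real (1 / (1 + (norm z)\<^sup>2)\<^sup>2))
        \<longlonglongrightarrow> \<phi> 0 * complex_of_real (1 / (1 + (norm z)\<^sup>2)\<^sup>2)"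
    proof (rule AE_I2)
      fix z :: complex
      have "(\<lambda>n. d n *\<^sub>R z) \<longlonglongrightarrow> 0 *\<^sub>R z" by (intro tendsto_intros d0)
      then have "(\<lambda>n. \<phi> (d n *\<^sub>R z)) \<longlonglongrightarrow> \<phi> (0 *\<^sub>R z)"
        using \<phi> by (intro isCont_tendsto_compose[of _ \<phi>]) (auto simp: continuous_on_eq_continuous_at)
      then show "(\<lambda>n. \<phi> (d n *\<^sub>R z) * complex_of_real (1 / (1 + (norm z)\<^sup>2)\<^sup>2))
        \<longlonglongrightarrow> \<phi> 0 * complex_of_real (1 / (1 + (norm z)\<^sup>2)\<^sup>2)"
        by (intro tendsto_intros) auto
    qed
    show "AE z in lborel. norm (\<phi> (d n *\<^sub>R z) * complex_of_real (1 / (1 + (norm z)\<^sup>2)\<^sup>2))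
        \<le> M * (1 / (1 + (norm z)\<^sup>2)\<^sup>2)" for n
      unfolding norm_mult norm_of_real
      by (intro AE_I2 mult_mono M) auto
  qed auto
  have "(LINT z|lborel. complex_of_real (1 / (1 + (norm (z::complex))\<^sup>2)\<^sup>2)) = complex_of_real pi"
    using has_bochner_integral_inverse_one_plus_norm_sq
    unfolding integral_complex_of_real by (simp add: has_bochner_integral_iff)
  then have "(LINT z|lborel. \<phi> 0 * complex_of_real (1 / (1 + (norm (z::complex))\<^sup>2)\<^sup>2)) = \<phi> 0 * complex_of_real pi"
    by (metis integral_mult_right_zero)
  with lim2 have "(\<lambda>n. - (LINT z|lborel. \<phi> z * q (d n) z)) \<longlonglongrightarrow> - (\<phi> 0 * pi)"
    by (intro tendsto_minus) simp
  then have "(\<lambda>n. LINT z|lborel. e z * k (d n) z) \<longlonglongrightarrow> - (\<phi> 0 * pi)"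
    using key[OF d] by simp
  from LIMSEQ_unique[OF lim1 this] show ?thesis by (simp add: e_def mult.commute)
qed

section \<open>Smooth functions\<close>

lemma Ck_SucI:
  assumes "\<And>x. (f has_derivative f' x) (at x)" and "\<And>v. Ck k (\<lambda>x. f' x v)"
  shows "Ck (Suc k) f"
proof -
  have "frechet_derivative f (at x) = f' x" for x
    using frechet_derivative_at[OF assms(1)] by simp
  then show ?thesis using assms by (auto simp: differentiable_def)
qed

lemma Ck_SucD:
  assumes "Ck (Suc k) f"
  shows "(f has_derivative frechet_derivative f (at x)) (at x)" and "Ck k (\<lambda>x. frechet_derivative f (at x) v)"
  using assms by (auto simp: frechet_derivative_works)

lemma Ck_Suc_imp_Ck: "Ck (Suc k) f \<Longrightarrow> Ck k f"
proof (induction k arbitrary: f)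
  case 0
  then show ?case
    using Ck_SucD(1)[OF 0] by (auto simp: continuous_on_eq_continuous_at intro: has_derivative_continuous)
next
  case (Suc k)
  show ?case
    by (rule Ck_SucI[OF Ck_SucD(1)[OF Suc.prems]], rule Suc.IH[OF Ck_SucD(2)[OF Suc.prems]])
qed

lemma Ck_imp_continuous_on: "Ck k f \<Longrightarrow> continuous_on UNIV f"
  by (induction k) (auto dest: Ck_Suc_imp_Ck simp del: Ck.simps(2))

lemma Ck_const: "Ck k (\<lambda>_. c)"
proof (induction k arbitrary: c)
  case (Suc k)
  show ?case by (rule Ck_SucI[of _ "\<lambda>_ _. 0"]) (auto intro: Suc)
qed auto

lemma Ck_bounded_linear:
  assumes "bounded_linear f"
  shows "Ck k f"
proof (cases k)
  case 0
  then show ?thesis using linear_continuous_on[OF assms] by simp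
next
  case (Suc l)
  show ?thesis unfolding Suc
    by (rule Ck_SucI[of _ "\<lambda>_. f"]) (auto intro: Ck_const bounded_linear_imp_has_derivative assms)
qed

lemma Ck_add: "Ck k f \<Longrightarrow> Ck k g \<Longrightarrow> Ck k (\<lambda>x. f x + g x)"
proof (induction k arbitrary: f g)
  case (Suc k)
  show ?case
    by (rule Ck_SucI[OF has_derivative_add[OF Ck_SucD(1)[OF Suc.prems(1)] Ck_SucD(1)[OF Suc.prems(2)]]],
        rule Suc.IH[OF Ck_SucD(2)[OF Suc.prems(1)] Ck_SucD(2)[OF Suc.prems(2)]])
qed (auto intro: continuous_intros)

lemma Ck_mult: "Ck k f \<Longrightarrow> Ck k g \<Longrightarrow> Ck k (\<lambda>x. f x * g x)"
proof (induction k arbitrary: f g)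
  case (Suc k)
  show ?case
    by (rule Ck_SucI[OF has_derivative_mult[OF Ck_SucD(1)[OF Suc.prems(1)] Ck_SucD(1)[OF Suc.prems(2)]]])
      (intro Ck_add Suc.IH Ck_SucD(2) Suc.prems Ck_Suc_imp_Ck)
qed (auto intro: continuous_intros)

lemma Ck_diff: "Ck k f \<Longrightarrow> Ck k g \<Longrightarrow> Ck k (\<lambda>x. f x - g x)"
  using Ck_add[of k f "\<lambda>x. - 1 * g x"] Ck_mult[OF Ck_const[of k "- 1"], of g] by simp

lemma Ck_prod: "(\<And>i. i \<in> A \<Longrightarrow> Ck k (f i)) \<Longrightarrow> Ck k (\<lambda>x. \<Prod>i\<in>A. f i x)"
  by (induction A rule: infinite_finite_induct) (auto intro: Ck_const Ck_mult)

lemma Ck_power: "Ck k f \<Longrightarrow> Ck k (\<lambda>x. f x ^ n)"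
  by (induction n) (auto intro: Ck_const Ck_mult)

lemma Ck_compose_linear:
  fixes f :: "'b::euclidean_space \<Rightarrow> complex" and L :: "'a::euclidean_space \<Rightarrow> 'b"
  assumes L: "bounded_linear L"
  shows "Ck k f \<Longrightarrow> Ck k (\<lambda>x. f (L x))"
proof (induction k arbitrary: f)
  case 0
  then show ?case
    using continuous_on_compose2[of UNIV f UNIV L] linear_continuous_on[OF L] by auto
next
  case (Suc k)
  show ?case
    by (rule Ck_SucI[OF has_derivative_compose[OF bounded_linear_imp_has_derivative[OF L] Ck_SucD(1)[OF Suc.prems]]],
        rule Suc.IH[OF Ck_SucD(2)[OF Suc.prems]])
qed

section \<open>Smooth bump functions and cut-offs exhausting an open set\<close>

text \<open>Differentiation maps the linear span of these functions to itself.\<close>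

definition flat :: "nat \<Rightarrow> real \<Rightarrow> real" where
  "flat n x = (if 0 < x then (1 / x) ^ n * exp (- (1 / x)) else 0)"

text \<open>From the right this is y^n / exp y at infinity with y = 1/x; from the left the function
  is 0.\<close>

lemma flat_tendsto_0: "(flat n \<longlongrightarrow> 0) (at 0)"
proof -
  have "((\<lambda>x. inverse x ^ n / exp (inverse x)) \<longlongrightarrow> (0::real)) (at_right 0)"
    by (rule filterlim_compose[OF tendsto_power_div_exp_0 filterlim_inverse_at_top_right])
  then have "(flat n \<longlongrightarrow> 0) (at_right 0)"
    by (rule Lim_transform_eventually)
      (auto simp: flat_def eventually_at_filter exp_minus inverse_eq_divide)
  moreover have "(flat n \<longlongrightarrow> 0) (at_left 0)"
    by (rule Lim_transform_eventually[OF tendsto_const]) (auto simp: flat_def eventually_at_filter)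
  ultimately show ?thesis by (simp add: filterlim_split_at_real)
qed

lemma flat_has_real_derivative:
  "(flat n has_real_derivative flat (n + 2) x - n * flat (n + 1) x) (at x)"
proof -
  consider "x < 0" | "x = 0" | "0 < x" by linarith
  then show ?thesis
  proof cases
    case 1
    have "((\<lambda>_. 0) has_real_derivative 0) (at x)" by auto
    then have "(flat n has_real_derivative 0) (at x)"
      by (rule has_field_derivative_transform_within_open[of _ _ _ "{..<0}"]) (use 1 in \<open>auto simp: flat_def\<close>)
    then show ?thesis using 1 by (simp add: flat_def)
  next
    case 2
    \<comment> \<open>The difference quotient at 0 is \<open>flat (n + 1)\<close>: dividing by
      \<open>y\<close> raises the power of 1/y by one.\<close>
    have "((\<lambda>y. (flat n y - flat n 0) / (y - 0)) \<longlongrightarrow> 0) (at 0)"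
      by (rule Lim_transform_eventually[OF flat_tendsto_0[of "n + 1"]])
        (auto simp: flat_def eventually_at_filter)
    then show ?thesis using 2 by (simp add: has_field_derivative_iff flat_def)
  next
    case 3
    have "((\<lambda>x. (1 / x) ^ n * exp (- (1 / x))) has_real_derivative
        (n * (1 / x) ^ (n - 1) * (- (1 / x)\<^sup>2)) * exp (- (1 / x)) + (exp (- (1 / x)) * (1 / x)\<^sup>2) * (1 / x) ^ n) (at x)"
      using 3 by (auto intro!: derivative_eq_intros simp: power2_eq_square)
    also have "(n * (1 / x) ^ (n - 1) * (- (1 / x)\<^sup>2)) * exp (- (1 / x)) + (exp (- (1 / x)) * (1 / x)\<^sup>2) * (1 / x) ^ n
        = flat (n + 2) x - n * flat (n + 1) x"
    proof -
      \<comment> \<open>For \<open>n = 0\<close> the truncated exponent \<open>n - 1\<close> does no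
        harm, as the factor \<open>n\<close> is zero.\<close>
      have "n * y ^ (n - 1) * (- y\<^sup>2) * e + e * y\<^sup>2 * y ^ n = y ^ (n + 2) * e - n * (y ^ (n + 1) * e)" for y e :: real
        by (cases n) (auto simp: algebra_simps power2_eq_square)
      from this[of "1 / x" "exp (- (1 / x))"] show ?thesis using 3 by (simp only: flat_def if_True)
    qed
    finally have "((\<lambda>x. (1 / x) ^ n * exp (- (1 / x))) has_real_derivative flat (n + 2) x - n * flat (n + 1) x) (at x)" .
    then show ?thesis
      by (rule has_field_derivative_transform_within_open[of _ _ _ "{0<..}"]) (use 3 in \<open>auto simp: flat_def\<close>)
  qed
qed

lemma flat_0_bounds: "0 \<le> flat 0 x" "flat 0 x < 1" "0 < flat 0 x \<longleftrightarrow> 0 < x"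
  by (auto simp: flat_def)

text \<open>Composing with r^2 - |z - a|^2, a polynomial, keeps smoothness at the centre, where the
  norm itself is not differentiable. The induction is for all \<open>n\<close> at once because
  differentiation raises \<open>n\<close>.\<close>

lemma Ck_flat_ball:
  fixes a :: "'a::euclidean_space"
  shows "Ck k (\<lambda>z. complex_of_real (flat n (r\<^sup>2 - (z - a) \<bullet> (z - a))))"
proof (induction k arbitrary: n)
  case 0
  have "continuous_on UNIV (flat n)"
    using flat_has_real_derivative by (auto simp: continuous_on_eq_continuous_at intro: DERIV_isCont)
  then have "continuous_on UNIV (\<lambda>z. flat n (r\<^sup>2 - (z - a) \<bullet> (z - a)))"
    by (rule continuous_on_compose2) (auto intro!: continuous_intros)
  then show ?case by (auto intro!: continuous_intros)
next
  case (Suc k)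
  let ?q = "\<lambda>z. r\<^sup>2 - (z - a) \<bullet> (z - a)"
  have q: "(?q has_derivative (\<lambda>v. - 2 * ((z - a) \<bullet> v))) (at z)" for z
    by (auto intro!: derivative_eq_intros simp: inner_commute)
  have d: "((\<lambda>z. complex_of_real (flat n (?q z))) has_derivative
      (\<lambda>v. (complex_of_real (flat (n + 2) (?q z)) - of_nat n * complex_of_real (flat (n + 1) (?q z)))
          * complex_of_real (- 2 * ((z - a) \<bullet> v)))) (at z)" for z
  proof -
    have "((\<lambda>z. flat n (?q z)) has_derivative
      (\<lambda>v. (flat (n + 2) (?q z) - n * flat (n + 1) (?q z)) * (- 2 * ((z - a) \<bullet> v)))) (at z)"
      using has_derivative_compose[OF q flat_has_real_derivative[unfolded has_field_derivative_def]] .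
    from has_derivative_of_real[OF this, where 'a=complex] show ?thesis by simp
  qed
  have lin: "Ck k (\<lambda>z. complex_of_real (- 2 * ((z - a) \<bullet> v)))" for v
  proof -
    have "Ck k (\<lambda>z. complex_of_real (z \<bullet> v))"
      by (intro Ck_bounded_linear bounded_linear_compose[OF bounded_linear_of_real] bounded_linear_inner_left)
    then have "Ck k (\<lambda>z. - 2 * (complex_of_real (z \<bullet> v) - complex_of_real (a \<bullet> v)))"
      by (intro Ck_mult Ck_diff Ck_const)
    then show ?thesis by (simp add: inner_diff_left)
  qed
  show ?case
    by (rule Ck_SucI[OF d]) (intro Ck_mult Ck_diff Ck_const Suc.IH lin)
qed

text \<open>Lindelof's theorem for the balls whose closed balls lie in \<open>U\<close>. Closed
  balls inside \<open>U\<close> are asked for since finite unions of them will be the compact sets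
  carrying the cut-offs.\<close>

lemma open_Union_balls:
  fixes U :: "'a::euclidean_space set"
  assumes "open U"
  obtains a :: "nat \<Rightarrow> 'a" and r :: "nat \<Rightarrow> real"
  where "\<And>i. cball (a i) (r i) \<subseteq> U" "U \<subseteq> (\<Union>i. ball (a i) (r i))"
proof -
  define \<F> where "\<F> = {ball x s |x s. cball x s \<subseteq> U}"
  have "\<And>S. S \<in> \<F> \<Longrightarrow> open S" by (auto simp: \<F>_def)
  then obtain \<F>' where \<F>': "\<F>' \<subseteq> \<F>" "countable \<F>'" "\<Union>\<F>' = \<Union>\<F>"
    using Lindelof by metis
  \<comment> \<open>A ball of negative radius is empty. Adding it makes the countable family
    nonempty, so that it can be enumerated even when \<open>U\<close> is empty.\<close>
  have "{} = ball (0::'a) (- 1)" "cball (0::'a) (- 1) \<subseteq> U" by (simp_all add: ball_empty)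
  then have empty: "{} \<in> \<F>" unfolding \<F>_def by blast
  define b where "b = from_nat_into (insert {} \<F>')"
  have range: "range b = insert {} \<F>'" unfolding b_def by (rule range_from_nat_into) (use \<F>' in auto)
  have "\<exists>x s. b i = ball x s \<and> cball x s \<subseteq> U" for i
  proof -
    have "b i \<in> insert {} \<F>'" using range rangeI[of b i] by simp
    then have "b i \<in> \<F>" using \<F>'(1) empty by auto
    then show ?thesis by (simp add: \<F>_def)
  qed
  then obtain a r where ar: "\<And>i. b i = ball (a i) (r i)" "\<And>i. cball (a i) (r i) \<subseteq> U" by metis
  have "U \<subseteq> \<Union>\<F>"
  proof
    fix x assume "x \<in> U"
    then obtain e where "0 < e" "cball x e \<subseteq> U" using assms open_contains_cball by blast
    then show "x \<in> \<Union>\<F>" unfolding \<F>_def using centre_in_ball by blast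
  qed
  also have "\<Union>\<F> = (\<Union>i. ball (a i) (r i))" using range ar(1) \<F>'(3) by auto
  finally show ?thesis using that ar(2) by blast
qed

lemma smooth_exhaustion:
  fixes U :: "'a::euclidean_space set"
  assumes "open U"
  obtains \<eta> :: "nat \<Rightarrow> 'a \<Rightarrow> complex" and K :: "nat \<Rightarrow> 'a set"
  where "\<And>n k. Ck k (\<eta> n)" "\<And>n z. norm (\<eta> n z) \<le> 1"
    "\<And>n. compact (K n)" "\<And>n. K n \<subseteq> U" "\<And>n z. \<eta> n z \<noteq> 0 \<Longrightarrow> z \<in> K n"
    "\<And>z. z \<in> U \<Longrightarrow> (\<lambda>n. \<eta> n z) \<longlonglongrightarrow> 1"
proof -
  obtain a :: "nat \<Rightarrow> 'a" and r where ar: "\<And>i. cball (a i) (r i) \<subseteq> U" "U \<subseteq> (\<Union>i. ball (a i) (r i))"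
    using open_Union_balls[OF assms] by blast
  \<comment> \<open>The guard matters: the centres may carry negative radii, and then
    \<open>(r i)\<^sup>2\<close> would still yield a nonzero bump.\<close>
  define b where "b i z = (if 0 < r i then flat 0 ((r i)\<^sup>2 - (z - a i) \<bullet> (z - a i)) else 0)" for i z
  have b: "0 \<le> b i z" "b i z < 1" for i z by (auto simp: b_def flat_0_bounds)
  have b_pos: "0 < b i z \<longleftrightarrow> z \<in> ball (a i) (r i)" for i z
  proof (cases "0 < r i")
    case True
    have "(0 < (r i)\<^sup>2 - (z - a i) \<bullet> (z - a i)) = (norm (z - a i) < r i)"
      using True by (simp add: dot_square_norm) (metis abs_norm_cancel abs_of_pos abs_square_less_1 norm_ge_zero power2_less_imp_less power_strict_mono zero_less_numeral less_imp_le)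
    then show ?thesis using True by (simp add: b_def flat_0_bounds dist_norm norm_minus_commute)
  next
    case False
    then show ?thesis by (simp add: b_def ball_empty)
  qed
  define P where "P n z = (\<Prod>i<n. 1 - b i z)" for n z
  have P: "0 \<le> P n z" "P n z \<le> 1" for n z
    unfolding P_def using b by (auto intro!: prod_nonneg prod_le_1 simp: less_imp_le)
  \<comment> \<open>At a point of \<open>U\<close> some bump is positive, which keeps the product
    below a fixed number less than 1 from some index on; the power \<open>n\<close> then drives it
    to 0. Where the first \<open>n\<close> bumps vanish, the product is 1 and the cut-off is
    0.\<close>
  define \<eta> where "\<eta> n z = 1 - (\<Prod>i<n. 1 - complex_of_real (b i z)) ^ n" for n z
  have \<eta>: "\<eta> n z = complex_of_real (1 - P n z ^ n)" for n z by (simp add: \<eta>_def P_def)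
  define K where "K n = (\<Union>i<n. cball (a i) (r i))" for n
  show ?thesis
  proof (rule that[of \<eta> K])
    fix n k
    have "Ck k (\<lambda>z. complex_of_real (b i z))" for i
      by (cases "0 < r i") (simp_all add: b_def Ck_flat_ball Ck_const)
    then show "Ck k (\<eta> n)" unfolding \<eta>_def[abs_def] by (intro Ck_diff Ck_const Ck_power Ck_prod)
  next
    fix n z
    have "0 \<le> P n z ^ n" "P n z ^ n \<le> 1" using P by (auto simp: power_le_one)
    then show "norm (\<eta> n z) \<le> 1" unfolding \<eta> norm_of_real by linarith
  next
    fix n show "compact (K n)" unfolding K_def by (intro compact_UN) auto
  next
    fix n show "K n \<subseteq> U" unfolding K_def using ar(1) by auto
  next
    fix n z assume *: "\<eta> n z \<noteq> 0"
    show "z \<in> K n"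
    proof (rule ccontr)
      assume "z \<notin> K n"
      then have "b i z = 0" if "i < n" for i
        using that b_pos[of i z] b(1)[of i z] ball_subset_cball[of "a i" "r i"] unfolding K_def by fastforce
      then have "P n z = 1" by (simp add: P_def)
      then show False using * by (simp add: \<eta>)
    qed
  next
    fix z assume "z \<in> U"
    then obtain i where i: "z \<in> ball (a i) (r i)" using ar(2) by auto
    then have bi: "0 < b i z" using b_pos by simp
    \<comment> \<open>Once \<open>n\<close> exceeds \<open>i\<close>, the factor 1 - b_i(z) < 1
      occurs in the product, and all other factors are at most 1.\<close>
    have le: "P n z ^ n \<le> (1 - b i z) ^ n" if "i < n" for n
    proof (rule power_mono[OF _ P(1)])
      have "P n z = (1 - b i z) * (\<Prod>j\<in>{..<n} - {i}. 1 - b j z)"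
        unfolding P_def using that by (intro prod.remove) auto
      also have "\<dots> \<le> (1 - b i z) * 1"
        using b by (intro mult_left_mono prod_le_1) (auto simp: less_imp_le)
      finally show "P n z \<le> 1 - b i z" by simp
    qed
    have "(\<lambda>n. P n z ^ n) \<longlonglongrightarrow> 0"
    proof (rule tendsto_sandwich[of "\<lambda>_. 0" _ _ "\<lambda>n. (1 - b i z) ^ n"])
      show "(\<lambda>n. (1 - b i z) ^ n) \<longlonglongrightarrow> 0"
        using b[of i z] bi by (intro LIMSEQ_realpow_zero) auto
      show "eventually (\<lambda>n. P n z ^ n \<le> (1 - b i z) ^ n) sequentially"
        using eventually_gt_at_top[of i] by eventually_elim (rule le)
    qed (use P in auto)
    then have "(\<lambda>n. complex_of_real (1 - P n z ^ n)) \<longlonglongrightarrow> complex_of_real (1 - 0)"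
      by (intro tendsto_intros)
    then show "(\<lambda>n. \<eta> n z) \<longlonglongrightarrow> 1" by (simp add: \<eta>)
  qed
qed

section \<open>Smoothness of convolutions\<close>

lemma integrable_bounded_tconv:
  fixes \<phi> :: "'a::euclidean_space \<Rightarrow> complex" and k :: "'b::euclidean_space \<Rightarrow> complex"
  assumes [measurable]: "\<phi> \<in> borel_measurable borel" and M: "\<And>z. norm (\<phi> z) \<le> M"
    and k: "integrable lborel k" and L[measurable]: "L \<in> borel_measurable borel"
  shows "integrable lborel (\<lambda>t. \<phi> (z + L t) * k t)"
proof (rule Bochner_Integration.integrable_bound)
  have [measurable]: "k \<in> borel_measurable borel" using k by auto
  show "integrable lborel (\<lambda>t. M * norm (k t))" using k by auto
  show "(\<lambda>t. \<phi> (z + L t) * k t) \<in> borel_measurable lborel" by measurable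
  have "0 \<le> M" using M[of 0] norm_ge_zero[of "\<phi> 0"] by linarith
  then show "AE t in lborel. norm (\<phi> (z + L t) * k t) \<le> norm (M * norm (k t))"
    by (auto simp: norm_mult intro!: mult_right_mono M)
qed

lemma norm_tconv_le:
  fixes \<phi> :: "'a::euclidean_space \<Rightarrow> complex" and k :: "'b::euclidean_space \<Rightarrow> complex"
  assumes [measurable]: "\<phi> \<in> borel_measurable borel" and M: "\<And>z. norm (\<phi> z) \<le> M"
    and k: "integrable lborel k" and L[measurable]: "L \<in> borel_measurable borel"
  shows "norm (tconv k L \<phi> z) \<le> M * (LINT t|lborel. norm (k t))"
proof -
  have "norm (tconv k L \<phi> z) \<le> (LINT t|lborel. norm (\<phi> (z + L t) * k t))"
    unfolding tconv_def by (rule integral_norm_bound)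
  also have "\<dots> \<le> (LINT t|lborel. M * norm (k t))"
    using integrable_norm[OF integrable_bounded_tconv[OF assms, of z]] k
    by (intro integral_mono) (auto simp: norm_mult intro!: mult_right_mono M)
  finally show ?thesis by simp
qed

text \<open>Differentiation under the integral sign. The normalised remainder of
  \<open>\<phi>\<close> tends to 0 pointwise and is bounded uniformly, so dominated convergence
  applies with |k| as weight; this tolerates the singularity of the kernel.\<close>

lemma has_derivative_tconv:
  fixes \<phi> :: "'a::euclidean_space \<Rightarrow> complex" and k :: "'b::euclidean_space \<Rightarrow> complex"
  assumes der: "\<And>z. (\<phi> has_derivative \<phi>' z) (at z)"
    and cont: "\<And>v. continuous_on UNIV (\<lambda>z. \<phi>' z v)"
    and supp: "\<And>z. B < norm z \<Longrightarrow> \<phi> z = 0"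
    and k: "integrable lborel k" and L[measurable]: "L \<in> borel_measurable borel"
  shows "(tconv k L \<phi> has_derivative (\<lambda>v. tconv k L (\<lambda>z. \<phi>' z v) z)) (at z)"
proof -
  have \<phi>: "continuous_on UNIV \<phi>"
    using der by (auto simp: continuous_on_eq_continuous_at intro: has_derivative_continuous)
  have supp': "B < norm z \<Longrightarrow> \<phi>' z v = 0" for z v
    by (rule has_derivative_zero_outside[OF der supp])
  have [measurable]: "k \<in> borel_measurable borel" using k by auto
  have [measurable]: "\<phi> \<in> borel_measurable borel" "(\<lambda>z. \<phi>' z v) \<in> borel_measurable borel" for v
    using \<phi> cont by (auto intro: borel_measurable_continuous_onI)
  obtain M0 where M0: "\<And>z. norm (\<phi> z) \<le> M0"
    using bounded_continuous_bounded_support[OF \<phi> supp] by blast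
  have "\<forall>v. \<exists>M. 0 \<le> M \<and> (\<forall>z. norm (\<phi>' z v) \<le> M)"
    using bounded_continuous_bounded_support[OF cont supp'] by metis
  then obtain Mv where Mv: "\<And>v. 0 \<le> Mv v" "\<And>v z. norm (\<phi>' z v) \<le> Mv v" by metis
  \<comment> \<open>Continuity is known direction by direction, so each direction has its own bound;
    summing over the basis gives a bound M |v| for every direction.\<close>
  define M where "M = (\<Sum>b\<in>Basis. Mv (b::'a))"
  have M: "norm (\<phi>' z v) \<le> M * norm v" for z v
  proof -
    interpret linear "\<phi>' z" by (rule has_derivative_linear[OF der])
    have "\<phi>' z v = \<phi>' z (\<Sum>b\<in>Basis. (v \<bullet> b) *\<^sub>R b)" by (simp add: euclidean_representation)
    also have "\<dots> = (\<Sum>b\<in>Basis. (v \<bullet> b) *\<^sub>R \<phi>' z b)" by (simp add: sum scale)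
    also have "norm \<dots> \<le> (\<Sum>b\<in>Basis. norm v * Mv b)"
      by (rule sum_norm_le) (auto intro!: mult_mono Basis_le_norm Mv)
    finally show ?thesis by (simp add: M_def sum_distrib_left mult.commute)
  qed
  have M_inc: "norm (\<phi> (w + h) - \<phi> w) \<le> M * norm h" for w h
    using directional_increment_bound[OF der M, of w 1 h] by simp
  have int\<phi>: "integrable lborel (\<lambda>t. \<phi> (w + L t) * k t)" for w
    by (rule integrable_bounded_tconv[OF _ M0 k L]) measurable
  have int\<phi>': "integrable lborel (\<lambda>t. \<phi>' (w + L t) v * k t)" for w v
    by (rule integrable_bounded_tconv[OF _ Mv(2) k L]) measurable
  let ?G = "\<lambda>v. tconv k L (\<lambda>z. \<phi>' z v) z"
  have lin: "linear ?G"
  proof (rule linearI)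
    have l: "linear (\<phi>' w)" for w by (rule has_derivative_linear[OF der])
    fix a b show "?G (a + b) = ?G a + ?G b"
      unfolding tconv_def using int\<phi>' by (simp add: linear_add[OF l] distrib_right)
    fix c show "?G (c *\<^sub>R a) = c *\<^sub>R ?G a"
      unfolding tconv_def by (simp add: linear_scale[OF l])
  qed
  show ?thesis
    unfolding has_derivative_at
  proof (intro conjI)
    show "bounded_linear ?G" using lin by (simp add: linear_conv_bounded_linear)
    show "((\<lambda>h. norm (tconv k L \<phi> (z + h) - tconv k L \<phi> z - ?G h) / norm h) \<longlongrightarrow> 0) (at 0)"
      unfolding tendsto_at_iff_sequentially
    proof (intro allI impI)
      fix X :: "nat \<Rightarrow> 'a"
      assume X: "\<forall>i. X i \<in> UNIV - {0}" "X \<longlonglongrightarrow> 0"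
      \<comment> \<open>The increment and the linear term each contribute at most M |X_i| to the
        numerator, hence the bound 2 M.\<close>
      define E where "E i t = norm (\<phi> (z + L t + X i) - \<phi> (z + L t) - \<phi>' (z + L t) (X i)) / norm (X i)" for i t
      have E_le: "E i t \<le> 2 * M" for i t
      proof -
        have "norm (\<phi> (z + L t + X i) - \<phi> (z + L t) - \<phi>' (z + L t) (X i)) \<le> M * norm (X i) + M * norm (X i)"
          by (intro order_trans[OF norm_triangle_ineq4] add_mono M M_inc)
        then show ?thesis using X(1) by (simp add: E_def field_simps)
      qed
      have [measurable]: "E i \<in> borel_measurable borel" for i unfolding E_def[abs_def] by measurable
      have E0: "0 \<le> E i t" for i t by (simp add: E_def)
      have intE: "integrable lborel (\<lambda>t. E i t * norm (k t))" for i
        by (rule Bochner_Integration.integrable_bound[of _ "\<lambda>t. 2 * M * norm (k t)"])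
          (use k E_le E0 in \<open>auto intro!: mult_right_mono order_trans[OF _ abs_ge_self]\<close>)
      have lim: "(\<lambda>i. LINT t|lborel. E i t * norm (k t)) \<longlonglongrightarrow> (LINT t|lborel. 0 * norm (k t))"
      proof (rule integral_dominated_convergence)
        show "integrable lborel (\<lambda>t. 2 * M * norm (k t))" using k by auto
        show "AE t in lborel. (\<lambda>i. E i t * norm (k t)) \<longlonglongrightarrow> 0 * norm (k t)"
        proof (rule AE_I2)
          fix t
          have "((\<lambda>h. norm (\<phi> (z + L t + h) - \<phi> (z + L t) - \<phi>' (z + L t) h) / norm h) \<longlongrightarrow> 0) (at 0)"
            using der[of "z + L t"] unfolding has_derivative_at by simp
          then have "(\<lambda>i. E i t) \<longlonglongrightarrow> 0"
            using X unfolding tendsto_at_iff_sequentially by (auto simp: E_def[abs_def] comp_def)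
          then show "(\<lambda>i. E i t * norm (k t)) \<longlonglongrightarrow> 0 * norm (k t)" by (intro tendsto_intros)
        qed
        show "AE t in lborel. norm (E i t * norm (k t)) \<le> 2 * M * norm (k t)" for i
          using E_le E0 by (auto intro!: mult_right_mono)
      qed auto
      have le: "norm (tconv k L \<phi> (z + X i) - tconv k L \<phi> z - ?G (X i)) / norm (X i) \<le> (LINT t|lborel. E i t * norm (k t))" for i
      proof -
        have "tconv k L \<phi> (z + X i) - tconv k L \<phi> z - ?G (X i) =
          (LINT t|lborel. (\<phi> (z + L t + X i) - \<phi> (z + L t) - \<phi>' (z + L t) (X i)) * k t)"
          unfolding tconv_def using int\<phi>[of "z + X i"] int\<phi>[of z] int\<phi>'[of z "X i"]
          by (simp add: right_diff_distrib ac_simps)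
        also have "norm \<dots> \<le> (LINT t|lborel. norm ((\<phi> (z + L t + X i) - \<phi> (z + L t) - \<phi>' (z + L t) (X i)) * k t))"
          by (rule integral_norm_bound)
        also have "\<dots> = (LINT t|lborel. norm (X i) * (E i t * norm (k t)))"
          using X(1) by (simp add: E_def norm_mult)
        also have "\<dots> = norm (X i) * (LINT t|lborel. E i t * norm (k t))"
          by (rule integral_mult_right_zero)
        finally show ?thesis using X(1) by (simp add: pos_divide_le_eq mult.commute)
      qed
      show "((\<lambda>h. norm (tconv k L \<phi> (z + h) - tconv k L \<phi> z - ?G h) / norm h) \<circ> X) \<longlonglongrightarrow> 0"
      proof (rule tendsto_sandwich[OF _ _ tendsto_const])
        show "(\<lambda>i. LINT t|lborel. E i t * norm (k t)) \<longlonglongrightarrow> 0" using lim by simp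
      qed (use le in auto)
    qed
  qed
qed

lemma frechet_derivative_zero_outside:
  assumes "Ck (Suc k) f" and "\<And>z. B < norm z \<Longrightarrow> f z = 0" and "B < norm z"
  shows "frechet_derivative f (at z) v = 0"
  by (rule has_derivative_zero_outside[OF Ck_SucD(1)[OF assms(1)] assms(2,3)])

text \<open>Derivatives fall on \<open>\<phi>\<close>. All orders are assumed because even the base
  case differentiates \<open>\<phi>\<close> once, and the induction passes to directional
  derivatives, again smooth and zero outside the same ball.\<close>

lemma Ck_tconv:
  fixes \<phi> :: "'a::euclidean_space \<Rightarrow> complex" and \<kappa> :: "'b::euclidean_space \<Rightarrow> complex"
  assumes \<kappa>: "integrable lborel \<kappa>" "L \<in> borel_measurable borel"
  shows "(\<And>k. Ck k \<phi>) \<Longrightarrow> (\<And>z. B < norm z \<Longrightarrow> \<phi> z = 0) \<Longrightarrow> Ck k (tconv \<kappa> L \<phi>)"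
proof (induction k arbitrary: \<phi>)
  case 0
  have "(tconv \<kappa> L \<phi> has_derivative (\<lambda>v. tconv \<kappa> L (\<lambda>z. frechet_derivative \<phi> (at z) v) z)) (at z)" for z
    by (rule has_derivative_tconv[OF Ck_SucD(1)[OF 0(1)] Ck_imp_continuous_on[OF Ck_SucD(2)[OF 0(1)]] 0(2) \<kappa>])
  then show ?case by (auto simp: continuous_on_eq_continuous_at intro: has_derivative_continuous)
next
  case (Suc k)
  have "(tconv \<kappa> L \<phi> has_derivative (\<lambda>v. tconv \<kappa> L (\<lambda>z. frechet_derivative \<phi> (at z) v) z)) (at z)" for z
    by (rule has_derivative_tconv[OF Ck_SucD(1)[OF Suc.prems(1)] Ck_imp_continuous_on[OF Ck_SucD(2)[OF Suc.prems(1)]] Suc.prems(2) \<kappa>])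
  then show ?case
    by (rule Ck_SucI)
      (auto intro!: Suc.IH Ck_SucD(2)[OF Suc.prems(1)] frechet_derivative_zero_outside[OF Suc.prems(1) Suc.prems(2)])
qed

section \<open>Test functions and the transposed Cauchy kernels\<close>

lemma has_derivative_zero_off_support:
  assumes "(f has_derivative f') (at z)" and "z \<notin> closure {x. f x \<noteq> 0}"
  shows "f' v = 0"
proof -
  have "(f has_derivative (\<lambda>_. 0)) (at z)"
    using assms(2) closure_subset[of "{x. f x \<noteq> 0}"]
    by (intro has_derivative_transform_within_open[OF has_derivative_const[of 0], of "- closure {x. f x \<noteq> 0}"]) auto
  from has_derivative_unique[OF assms(1) this] show ?thesis by simp
qed

lemma test_functions_bounded_support:
  assumes "\<phi> \<in> test_functions \<Omega>"
  obtains B where "\<And>z. B < norm z \<Longrightarrow> \<phi> z = 0"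
proof -
  have "bounded (closure {x. \<phi> x \<noteq> 0})" using assms by (auto simp: test_functions_def compact_imp_bounded)
  then obtain B where "\<forall>x\<in>closure {x. \<phi> x \<noteq> 0}. norm x \<le> B" unfolding bounded_iff by auto
  then show ?thesis using that[of B] closure_subset[of "{x. \<phi> x \<noteq> 0}"] by (force simp: not_le)
qed

lemma test_functionsI:
  assumes "\<And>k. Ck k \<phi>" and "compact S" "S \<subseteq> \<Omega>" and "\<And>z. \<phi> z \<noteq> 0 \<Longrightarrow> z \<in> S"
  shows "\<phi> \<in> test_functions \<Omega>"
proof -
  have "closure {x. \<phi> x \<noteq> 0} \<subseteq> S"
    using assms(2,4) by (intro closure_minimal) (auto intro: compact_imp_closed)
  then show ?thesis
    using assms compact_Int_closed[OF assms(2) closed_closure, of "{x. \<phi> x \<noteq> 0}"]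
    by (auto simp: test_functions_def Int_absorb1)
qed

lemma
  assumes C: "\<And>k. Ck k \<phi>"
  shows Ck_dbar1: "Ck k (dbar1 \<phi>)" and Ck_dbar2: "Ck k (dbar2 \<phi>)"
proof -
  have "Ck k (\<lambda>z. frechet_derivative \<phi> (at z) v)" for v by (rule Ck_SucD(2)[OF C])
  then show "Ck k (dbar1 \<phi>)" "Ck k (dbar2 \<phi>)"
    unfolding dbar1_def[abs_def] dbar2_def[abs_def] divide_inverse by (intro Ck_mult Ck_add Ck_const; simp)+
qed

lemma dbar1_zero_outside:
  assumes "Ck (Suc k) \<phi>" and "\<And>z. B < norm z \<Longrightarrow> \<phi> z = 0" and "B < norm z"
  shows "dbar1 \<phi> z = 0"
proof -
  have "frechet_derivative \<phi> (at z) v = 0" for v by (rule frechet_derivative_zero_outside[OF assms])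
  then show ?thesis by (simp add: dbar1_def)
qed

text \<open>The Cauchy-Pompeiu formula for the slice t -> phi(w1 - t, w2). The reflection of
  \<open>t\<close> changes the sign of dbar and cancels the minus sign of that formula.\<close>

lemma tconv_cauchy_kernel_dbar1:
  fixes \<phi> :: "C2 \<Rightarrow> complex"
  assumes \<phi>: "\<phi> \<in> test_functions (D1 \<times> D2)" and w: "w1 \<in> D1"
    and R: "\<And>a b. a \<in> D1 \<Longrightarrow> b \<in> D1 \<Longrightarrow> norm (a - b) < R"
  shows "tconv (cauchy_kernel R) (\<lambda>t. - (t, 0)) (dbar1 \<phi>) (w1, w2) = pi * \<phi> (w1, w2)"
proof -
  have C: "Ck k \<phi>" for k using \<phi> by (simp add: test_functions_def)
  note d = Ck_SucD(1)[OF C] and c = Ck_imp_continuous_on[OF Ck_SucD(2)[OF C]]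
  obtain B where B: "\<And>z. B < norm z \<Longrightarrow> \<phi> z = 0" using test_functions_bounded_support[OF \<phi>] by blast
  define \<psi> where "\<psi> t = \<phi> (w1 - t, w2)" for t
  define \<psi>' where "\<psi>' t v = frechet_derivative \<phi> (at (w1 - t, w2)) (- v, 0)" for t v
  have "((\<lambda>t. (w1 - t, w2)) has_derivative (\<lambda>v. (- v, 0))) (at t)" for t
    by (auto intro!: derivative_eq_intros)
  from has_derivative_compose[OF this d]
  have \<psi>': "(\<psi> has_derivative \<psi>' t) (at t)" for t
    unfolding \<psi>_def[abs_def] \<psi>'_def[abs_def] .
  have cont: "continuous_on UNIV (\<lambda>t. \<psi>' t v)" for v
    unfolding \<psi>'_def by (rule continuous_on_compose2[OF c]) (auto intro!: continuous_intros)
  have supp: "\<psi> t = 0" if "B + norm w1 < norm t" for t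
  proof -
    have "norm t - norm w1 \<le> norm (w1 - t)" by (metis norm_minus_commute norm_triangle_ineq2)
    also have "\<dots> \<le> norm (w1 - t, w2)" using norm_fst_le[of "w1 - t" w2] by simp
    finally show ?thesis unfolding \<psi>_def using that by (intro B) simp
  qed
  have neg: "(\<psi>' t 1 + \<i> * \<psi>' t \<i>) / 2 = - dbar1 \<phi> (w1 - t, w2)" for t
  proof -
    have "linear (frechet_derivative \<phi> (at (w1 - t, w2)))" by (rule has_derivative_linear[OF d])
    from linear_neg[OF this, of "(1, 0)"] linear_neg[OF this, of "(\<i>, 0)"] show ?thesis
      by (simp add: \<psi>'_def dbar1_def field_simps)
  qed
  \<comment> \<open>The cut-off is not seen: if |t| >= R, then w1 - t lies outside
    \<open>D1\<close>, hence off the support of \<open>\<phi>\<close>, and the derivative vanishes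
    there.\<close>
  have eq: "dbar1 \<phi> (w1 - t, w2) * cauchy_kernel R t = - ((\<psi>' t 1 + \<i> * \<psi>' t \<i>) / 2 * (1 / t))" for t
  proof (cases "norm t < R")
    case True
    then show ?thesis unfolding neg by (simp add: cauchy_kernel_def)
  next
    case False
    have "(w1 - t, w2) \<notin> closure {x. \<phi> x \<noteq> 0}"
    proof
      assume "(w1 - t, w2) \<in> closure {x. \<phi> x \<noteq> 0}"
      then have "w1 - t \<in> D1" using \<phi> by (auto simp: test_functions_def)
      from R[OF w this] False show False by simp
    qed
    then have "dbar1 \<phi> (w1 - t, w2) = 0"
      unfolding dbar1_def using has_derivative_zero_off_support[OF d] by simp
    then show ?thesis unfolding neg by simp
  qed
  have "tconv (cauchy_kernel R) (\<lambda>t. - (t, 0)) (dbar1 \<phi>) (w1, w2) =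
      (LINT t|lborel. - ((\<psi>' t 1 + \<i> * \<psi>' t \<i>) / 2 * (1 / t)))"
    unfolding tconv_def eq[symmetric] by simp
  also have "\<dots> = pi * \<psi> 0"
    using Cauchy_Pompeiu_compact_support[OF \<psi>' cont cont supp] unfolding integral_minus by (simp only: minus_minus)
  finally show ?thesis by (simp add: \<psi>_def)
qed

text \<open>Lets the weak equation for f2 be applied to the transposed convolution of
  \<open>\<phi>\<close>.\<close>

lemma dbar1_tconv:
  assumes C: "\<And>k. Ck k \<phi>" and B: "\<And>z. B < norm z \<Longrightarrow> \<phi> z = 0"
    and \<kappa>: "integrable lborel \<kappa>" "L \<in> borel_measurable borel"
  shows "dbar1 (tconv \<kappa> L \<phi>) = tconv \<kappa> L (dbar1 \<phi>)"
proof
  fix z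
  note c = Ck_imp_continuous_on[OF Ck_SucD(2)[OF C]]
  have fd: "frechet_derivative (tconv \<kappa> L \<phi>) (at z) v = tconv \<kappa> L (\<lambda>z. frechet_derivative \<phi> (at z) v) z" for v
    using frechet_derivative_at[OF has_derivative_tconv[OF Ck_SucD(1)[OF C] c B \<kappa>]] by metis
  have int: "integrable lborel (\<lambda>t. frechet_derivative \<phi> (at (z + L t)) v * \<kappa> t)" for v
  proof -
    have "frechet_derivative \<phi> (at z) v = 0" if "B < norm z" for z
      by (rule frechet_derivative_zero_outside[OF C B that])
    then obtain M where "\<And>z. norm (frechet_derivative \<phi> (at z) v) \<le> M"
      using bounded_continuous_bounded_support[OF c] by blast
    then show ?thesis
      by (intro integrable_bounded_tconv[OF _ _ \<kappa>] borel_measurable_continuous_onI c)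
  qed
  show "dbar1 (tconv \<kappa> L \<phi>) z = tconv \<kappa> L (dbar1 \<phi>) z"
    unfolding dbar1_def fd unfolding tconv_def using int
    by (simp add: distrib_right add_divide_distrib mult.assoc)
qed

section \<open>The weak equations for Borel functions\<close>

text \<open>With the integral over the first variable inside, the slice formula removes one kernel.
  It holds for every second coordinate, in particular for w2 - t2 outside \<open>D2\<close>.\<close>

lemma tconv_product_kernel_dbar1:
  fixes \<phi> :: "C2 \<Rightarrow> complex"
  assumes \<phi>: "\<phi> \<in> test_functions (D1 \<times> D2)" and w: "w1 \<in> D1"
    and R: "\<And>a b. a \<in> D1 \<Longrightarrow> b \<in> D1 \<Longrightarrow> norm (a - b) < R"
  shows "tconv (\<lambda>t. cauchy_kernel R (fst t) * cauchy_kernel R (snd t)) (\<lambda>t. - t) (dbar1 \<phi>) (w1, w2) =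
    pi * tconv (cauchy_kernel R) (\<lambda>t. - (0, t)) \<phi> (w1, w2)"
proof -
  let ?k = "cauchy_kernel R"
  have C: "Ck k \<phi>" for k using \<phi> by (simp add: test_functions_def)
  obtain B where B: "\<And>z. B < norm z \<Longrightarrow> \<phi> z = 0" using test_functions_bounded_support[OF \<phi>] by blast
  have c: "continuous_on UNIV (dbar1 \<phi>)" by (rule Ck_imp_continuous_on[OF Ck_dbar1[OF C]])
  have [measurable]: "dbar1 \<phi> \<in> borel_measurable borel" by (rule borel_measurable_continuous_onI[OF c])
  have "dbar1 \<phi> z = 0" if "B < norm z" for z by (rule dbar1_zero_outside[OF C B that])
  then obtain M where M: "\<And>z. norm (dbar1 \<phi> z) \<le> M" using bounded_continuous_bounded_support[OF c] by blast
  have int: "integrable (lborel \<Otimes>\<^sub>M lborel) (\<lambda>(t1, t2). dbar1 \<phi> ((w1, w2) - (t1, t2)) * (?k t1 * ?k t2))"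
  proof (rule Bochner_Integration.integrable_bound)
    show "integrable (lborel \<Otimes>\<^sub>M lborel) (\<lambda>x. complex_of_real M * (case x of (t1, t2) \<Rightarrow> ?k t1 * ?k t2))"
      by (intro integrable_mult_right integrable_tensor integrable_cauchy_kernel)
    have "0 \<le> M" using M[of 0] norm_ge_zero[of "dbar1 \<phi> 0"] by linarith
    then show "AE x in lborel \<Otimes>\<^sub>M lborel. norm (case x of (t1, t2) \<Rightarrow> dbar1 \<phi> ((w1, w2) - (t1, t2)) * (?k t1 * ?k t2))
        \<le> norm (complex_of_real M * (case x of (t1, t2) \<Rightarrow> ?k t1 * ?k t2))"
      by (auto simp: norm_mult intro!: mult_right_mono M always_eventually simp del: diff_Pair)
  qed measurable
  have "tconv (\<lambda>t. ?k (fst t) * ?k (snd t)) (\<lambda>t. - t) (dbar1 \<phi>) (w1, w2)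
     = (LINT t|(lborel \<Otimes>\<^sub>M lborel). (case t of (t1, t2) \<Rightarrow> dbar1 \<phi> ((w1, w2) - (t1, t2)) * (?k t1 * ?k t2)))"
    unfolding tconv_def lborel_prod by (intro Bochner_Integration.integral_cong) auto
  also have "\<dots> = (LINT t2|lborel. LINT t1|lborel. dbar1 \<phi> ((w1, w2) - (t1, t2)) * (?k t1 * ?k t2))"
    by (rule lborel_pair.integral_snd[OF int, symmetric])
  also have "\<dots> = (LINT t2|lborel. tconv ?k (\<lambda>t. - (t, 0)) (dbar1 \<phi>) (w1, w2 - t2) * ?k t2)"
    unfolding tconv_def by (simp flip: integral_mult_left_zero) (simp add: ac_simps)
  also have "\<dots> = (LINT t2|lborel. pi * (\<phi> (w1, w2 - t2) * ?k t2))"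
    by (simp only: tconv_cauchy_kernel_dbar1[OF \<phi> w R] mult.assoc)
  also have "\<dots> = pi * tconv ?k (\<lambda>t. - (0, t)) \<phi> (w1, w2)"
    unfolding tconv_def by simp
  finally show ?thesis .
qed

text \<open>The weak equation is tested on a function whose support is compact in the first variable
  only: multiplication by a cut-off in the second variable commutes with \<open>dbar1\<close>.\<close>

lemma weak_dbar1_partial_transpose:
  assumes \<phi>: "\<phi> \<in> test_functions (D1 \<times> D2)" and D2: "open D2"
    and f: "integrable lborel f" "\<And>z. z \<notin> D1 \<times> D2 \<Longrightarrow> f z = 0"
    and g: "integrable lborel g" "\<And>z. z \<notin> D1 \<times> D2 \<Longrightarrow> g z = 0"
    and weak: "\<And>\<theta>. \<theta> \<in> test_functions (D1 \<times> D2) \<Longrightarrow>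
       - (LINT z|lborel. f z * dbar1 \<theta> z) = (LINT z|lborel. g z * \<theta> z)"
    and k: "integrable lborel k"
  shows "(LINT w|lborel. f w * tconv k (\<lambda>t. - (0, t)) (dbar1 \<phi>) w) =
    - (LINT w|lborel. g w * tconv k (\<lambda>t. - (0, t)) \<phi> w)"
proof -
  let ?L = "\<lambda>t::complex. - (0::complex, t)"
  have L[measurable]: "?L \<in> borel_measurable borel" by measurable
  have C: "Ck k \<phi>" for k using \<phi> by (simp add: test_functions_def)
  obtain B where B: "\<And>z. B < norm z \<Longrightarrow> \<phi> z = 0" using test_functions_bounded_support[OF \<phi>] by blast
  define K where "K = tconv k ?L \<phi>"
  have K: "Ck n K" for n unfolding K_def by (rule Ck_tconv[OF k L C B])
  have dK: "dbar1 K = tconv k ?L (dbar1 \<phi>)" unfolding K_def by (rule dbar1_tconv[OF C B k L])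
  have cK: "continuous_on UNIV K" "continuous_on UNIV (dbar1 K)"
    by (rule Ck_imp_continuous_on[OF K] Ck_imp_continuous_on[OF Ck_dbar1[OF K]])+
  have c: "continuous_on UNIV \<phi>" "continuous_on UNIV (dbar1 \<phi>)"
    by (rule Ck_imp_continuous_on[OF C] Ck_imp_continuous_on[OF Ck_dbar1[OF C]])+
  \<comment> \<open>\<open>K\<close> need not have bounded support. Its bound, like that of
    \<open>dbar1 K\<close>, comes from the function convolved and the L^1 norm of
    \<open>k\<close>.\<close>
  obtain M0 where "\<And>z. norm (\<phi> z) \<le> M0" using bounded_continuous_bounded_support[OF c(1) B] by blast
  then have "norm (K z) \<le> M0 * (LINT t|lborel. norm (k t))" for z
    unfolding K_def by (intro norm_tconv_le k L borel_measurable_continuous_onI c)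
  then obtain M where M: "\<And>z. norm (K z) \<le> M" by blast
  have "dbar1 \<phi> z = 0" if "B < norm z" for z by (rule dbar1_zero_outside[OF C B that])
  then obtain M1 where "\<And>z. norm (dbar1 \<phi> z) \<le> M1" using bounded_continuous_bounded_support[OF c(2)] by blast
  then have "norm (dbar1 K z) \<le> M1 * (LINT t|lborel. norm (k t))" for z
    unfolding dK by (intro norm_tconv_le k L borel_measurable_continuous_onI c)
  then obtain M' where M': "\<And>z. norm (dbar1 K z) \<le> M'" by blast
  \<comment> \<open>The convolution shifts the second coordinate only, so the first coordinates
    where \<open>K\<close> is nonzero stay in the projection of the support of
    \<open>\<phi>\<close>.\<close>
  define S where "S = fst ` closure {x. \<phi> x \<noteq> 0}"
  have S: "compact S" "S \<subseteq> D1"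
    using \<phi> unfolding S_def test_functions_def by (auto intro!: compact_continuous_image continuous_intros)
  have K_S: "fst z \<in> S" if "K z \<noteq> 0" for z
  proof (rule ccontr)
    assume *: "fst z \<notin> S"
    have "\<phi> (z + ?L t) = 0" for t
    proof (rule ccontr)
      assume "\<phi> (z + ?L t) \<noteq> 0"
      then have "fst (z + ?L t) \<in> S" unfolding S_def by (intro imageI subsetD[OF closure_subset]) simp
      then show False using * by simp
    qed
    then show False using that by (simp add: K_def tconv_def)
  qed
  obtain \<eta> :: "nat \<Rightarrow> complex \<Rightarrow> complex" and Q where \<eta>: "\<And>n k. Ck k (\<eta> n)" "\<And>n z. norm (\<eta> n z) \<le> 1"
    "\<And>n. compact (Q n)" "\<And>n. Q n \<subseteq> D2" "\<And>n z. \<eta> n z \<noteq> 0 \<Longrightarrow> z \<in> Q n"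
    "\<And>z. z \<in> D2 \<Longrightarrow> (\<lambda>n. \<eta> n z) \<longlonglongrightarrow> 1"
    using smooth_exhaustion[OF D2] by metis
  define \<theta> where "\<theta> n z = \<eta> n (snd z) * K z" for n z
  have \<theta>: "\<theta> n \<in> test_functions (D1 \<times> D2)" for n
  proof (rule test_functionsI)
    show "Ck j (\<theta> n)" for j unfolding \<theta>_def[abs_def]
      by (intro Ck_mult K Ck_compose_linear[OF bounded_linear_snd] \<eta>)
    show "compact (S \<times> Q n)" by (intro compact_Times S \<eta>)
    show "S \<times> Q n \<subseteq> D1 \<times> D2" using S \<eta>(4)[of n] by auto
    show "z \<in> S \<times> Q n" if "\<theta> n z \<noteq> 0" for z
      using that K_S[of z] \<eta>(5)[of n "snd z"] by (cases z) (auto simp: \<theta>_def)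
  qed
  \<comment> \<open>An increment \<open>(v, 0)\<close> does not move \<open>snd z\<close>, so the
    derivative of the cut-off contributes nothing.\<close>
  have d\<theta>: "dbar1 (\<theta> n) z = \<eta> n (snd z) * dbar1 K z" for n z
  proof -
    have "((\<lambda>z. \<eta> n (snd z)) has_derivative (\<lambda>v. frechet_derivative (\<eta> n) (at (snd z)) (snd v))) (at z)"
      by (rule has_derivative_compose[OF bounded_linear_imp_has_derivative[OF bounded_linear_snd] Ck_SucD(1)[OF \<eta>(1)]])
    from has_derivative_mult[OF this Ck_SucD(1)[OF K]]
    have "(\<theta> n has_derivative (\<lambda>v. \<eta> n (snd z) * frechet_derivative K (at z) v +
        frechet_derivative (\<eta> n) (at (snd z)) (snd v) * K z)) (at z)"
      unfolding \<theta>_def[abs_def] .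
    from frechet_derivative_at[OF this, symmetric]
    have "frechet_derivative (\<theta> n) (at z) (v, 0) = \<eta> n (snd z) * frechet_derivative K (at z) (v, 0)" for v
      using linear_0[OF has_derivative_linear[OF Ck_SucD(1)[OF \<eta>(1)[of "Suc 0" n]]]] by simp
    then show ?thesis unfolding dbar1_def by (simp add: algebra_simps)
  qed
  have [measurable]: "f \<in> borel_measurable borel" "g \<in> borel_measurable borel" using f g by auto
  have [measurable]: "K \<in> borel_measurable borel" "dbar1 K \<in> borel_measurable borel"
    by (auto intro: borel_measurable_continuous_onI cK)
  have [measurable]: "(\<lambda>z::C2. \<eta> n (snd z)) \<in> borel_measurable borel" for n
    by (rule borel_measurable_continuous_onI[OF Ck_imp_continuous_on[OF Ck_compose_linear[OF bounded_linear_snd \<eta>(1)]]])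
  \<comment> \<open>Off the product, where the cut-offs need not tend to 1, \<open>h\<close> is
    zero.\<close>
  have lim: "(\<lambda>n. LINT z|lborel. h z * (\<eta> n (snd z) * u z)) \<longlonglongrightarrow> (LINT z|lborel. h z * u z)"
    if h: "integrable lborel h" "\<And>z. z \<notin> D1 \<times> D2 \<Longrightarrow> h z = 0"
      and u[measurable]: "u \<in> borel_measurable borel" and N: "\<And>z. norm (u z) \<le> N" for h u :: "C2 \<Rightarrow> complex" and N
  proof (rule integral_dominated_convergence)
    have [measurable]: "h \<in> borel_measurable borel" using h by auto
    show "(\<lambda>z. h z * u z) \<in> borel_measurable lborel" "(\<lambda>z. h z * (\<eta> n (snd z) * u z)) \<in> borel_measurable lborel" for n
      by measurable
    show "integrable lborel (\<lambda>z. norm (h z) * N)" using h by auto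
    show "AE z in lborel. (\<lambda>n. h z * (\<eta> n (snd z) * u z)) \<longlonglongrightarrow> h z * u z"
    proof (rule AE_I2)
      fix z
      show "(\<lambda>n. h z * (\<eta> n (snd z) * u z)) \<longlonglongrightarrow> h z * u z"
      proof (cases "z \<in> D1 \<times> D2")
        case True
        then have "(\<lambda>n. \<eta> n (snd z)) \<longlonglongrightarrow> 1" by (intro \<eta>) auto
        then have "(\<lambda>n. h z * (\<eta> n (snd z) * u z)) \<longlonglongrightarrow> h z * (1 * u z)" by (intro tendsto_intros)
        then show ?thesis by simp
      qed (simp add: h)
    qed
    show "AE z in lborel. norm (h z * (\<eta> n (snd z) * u z)) \<le> norm (h z) * N" for n
    proof (rule AE_I2)
      fix z
      have "norm (\<eta> n (snd z) * u z) \<le> 1 * N" unfolding norm_mult by (intro mult_mono \<eta> N) auto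
      then show "norm (h z * (\<eta> n (snd z) * u z)) \<le> norm (h z) * N"
        unfolding norm_mult[of "h z"] by (intro mult_left_mono) auto
    qed
  qed
  have "(\<lambda>n. - (LINT z|lborel. f z * (\<eta> n (snd z) * dbar1 K z))) \<longlonglongrightarrow> - (LINT z|lborel. f z * dbar1 K z)"
    by (intro tendsto_minus lim[OF f _ M']) measurable
  moreover have "- (LINT z|lborel. f z * (\<eta> n (snd z) * dbar1 K z)) = (LINT z|lborel. g z * (\<eta> n (snd z) * K z))" for n
    using weak[OF \<theta>[of n]] unfolding d\<theta> unfolding \<theta>_def .
  ultimately have "(\<lambda>n. LINT z|lborel. g z * (\<eta> n (snd z) * K z)) \<longlonglongrightarrow> - (LINT z|lborel. f z * dbar1 K z)"
    by simp
  moreover have "(\<lambda>n. LINT z|lborel. g z * (\<eta> n (snd z) * K z)) \<longlonglongrightarrow> (LINT z|lborel. g z * K z)"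
    by (rule lim[OF g _ M]) measurable
  ultimately have "(LINT z|lborel. g z * K z) = - (LINT z|lborel. f z * dbar1 K z)"
    by (rule LIMSEQ_unique[rotated])
  then show ?thesis unfolding dK[symmetric] K_def[symmetric] by simp
qed

lemma borel_measurable_cauchy_kernel_fst [measurable]:
    "(\<lambda>t::C2. cauchy_kernel R (fst t)) \<in> borel_measurable borel"
  by (rule measurable_compose[OF borel_measurable_continuous_onI[OF continuous_on_fst[OF continuous_on_id]]
        borel_measurable_cauchy_kernel])

lemma borel_measurable_cauchy_kernel_snd [measurable]:
    "(\<lambda>t::C2. cauchy_kernel R (snd t)) \<in> borel_measurable borel"
  by (rule measurable_compose[OF borel_measurable_continuous_onI[OF continuous_on_snd[OF continuous_on_id]]
        borel_measurable_cauchy_kernel])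

text \<open>The formula for \<open>T\<close> with 2i/(2 pi i) = 1/pi and (2i)^2/(2 pi i)^2 = 1/pi^2
  carried out, and with integrals over all of space.\<close>

definition cauchy_potential :: "real \<Rightarrow> (C2 \<Rightarrow> complex) \<Rightarrow> (C2 \<Rightarrow> complex) \<Rightarrow> (C2 \<Rightarrow> complex) \<Rightarrow> C2 \<Rightarrow> complex" where
  "cauchy_potential R f1 f2 g z =
     - (tconv (cauchy_kernel R) (\<lambda>t. (0, t)) f2 z / pi)
     - tconv (cauchy_kernel R) (\<lambda>t. (t, 0)) f1 z / pi
     - tconv (\<lambda>t. cauchy_kernel R (fst t) * cauchy_kernel R (snd t)) (\<lambda>t. t) g z / pi\<^sup>2"

lemma integrable_product_kernel:
  "integrable lborel (\<lambda>t. cauchy_kernel R (fst t) * cauchy_kernel R (snd t))"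
proof -
  have "integrable (lborel \<Otimes>\<^sub>M lborel) (\<lambda>(s, t). cauchy_kernel R s * cauchy_kernel R t)"
    by (intro integrable_tensor integrable_cauchy_kernel)
  then show ?thesis by (simp add: lborel_prod case_prod_unfold)
qed

lemma weak_dbar1_cauchy_potential:
  assumes D2: "open D2"
    and R: "\<And>a b. a \<in> D1 \<Longrightarrow> b \<in> D1 \<Longrightarrow> norm (a - b) < R"
    and f1: "integrable lborel f1" "\<And>z. z \<notin> D1 \<times> D2 \<Longrightarrow> f1 z = 0"
    and f2: "integrable lborel f2" "\<And>z. z \<notin> D1 \<times> D2 \<Longrightarrow> f2 z = 0"
    and g: "integrable lborel g" "\<And>z. z \<notin> D1 \<times> D2 \<Longrightarrow> g z = 0"
    and weak: "\<And>\<theta>. \<theta> \<in> test_functions (D1 \<times> D2) \<Longrightarrow>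
       - (LINT z|lborel. f2 z * dbar1 \<theta> z) = (LINT z|lborel. g z * \<theta> z)"
    and \<phi>: "\<phi> \<in> test_functions (D1 \<times> D2)"
  shows "- (LINT z|lborel. cauchy_potential R f1 f2 g z * dbar1 \<phi> z) = (LINT z|lborel. f1 z * \<phi> z)"
proof -
  let ?k = "cauchy_kernel R" and ?kk = "\<lambda>t. cauchy_kernel R (fst t) * cauchy_kernel R (snd t)"
  let ?u2 = "tconv ?k (\<lambda>t. (0, t)) f2" and ?u1 = "tconv ?k (\<lambda>t. (t, 0)) f1" and ?u = "tconv ?kk (\<lambda>t. t) g"
  note k = integrable_cauchy_kernel[of R] and kk = integrable_product_kernel[of R]
  have L[measurable]: "(\<lambda>t::complex. (0::complex, t)) \<in> borel_measurable borel"
    "(\<lambda>t::complex. (t, 0::complex)) \<in> borel_measurable borel" "(\<lambda>t::C2. t) \<in> borel_measurable borel" by measurable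
  have C: "Ck k \<phi>" for k using \<phi> by (simp add: test_functions_def)
  obtain B where B: "\<And>z. B < norm z \<Longrightarrow> \<phi> z = 0" using test_functions_bounded_support[OF \<phi>] by blast
  have c: "continuous_on UNIV (dbar1 \<phi>)" by (rule Ck_imp_continuous_on[OF Ck_dbar1[OF C]])
  have m[measurable]: "dbar1 \<phi> \<in> borel_measurable borel" by (rule borel_measurable_continuous_onI[OF c])
  have "dbar1 \<phi> z = 0" if "B < norm z" for z by (rule dbar1_zero_outside[OF C B that])
  then obtain M where M: "\<And>z. norm (dbar1 \<phi> z) \<le> M" using bounded_continuous_bounded_support[OF c] by blast
  \<comment> \<open>Bounded times integrable, read as a convolution at the point 0 with the identity
    map and \<open>v\<close> as kernel.\<close>
  have int: "integrable lborel (\<lambda>z. v z * dbar1 \<phi> z)" if "integrable lborel v" for v :: "C2 \<Rightarrow> complex"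
    using integrable_bounded_tconv[OF m M that, of "\<lambda>t. t" 0] by (simp add: mult.commute)
  have i: "integrable lborel (\<lambda>z. ?u1 z * dbar1 \<phi> z)" "integrable lborel (\<lambda>z. ?u2 z * dbar1 \<phi> z)"
    "integrable lborel (\<lambda>z. ?u z * dbar1 \<phi> z)"
    by (intro int integrable_tconv f1 f2 g k kk L)+
  have e1: "(LINT z|lborel. ?u1 z * dbar1 \<phi> z) = pi * (LINT z|lborel. f1 z * \<phi> z)"
  proof -
    have "f1 w * tconv ?k (\<lambda>t. - (t, 0)) (dbar1 \<phi>) w = pi * (f1 w * \<phi> w)" for w
      using tconv_cauchy_kernel_dbar1[OF \<phi> _ R, of "fst w" "snd w"] f1(2)[of w]
      by (cases "w \<in> D1 \<times> D2") auto
    then show ?thesis unfolding tconv_transpose[OF f1(1) k L(2) m M] by (simp only: integral_mult_right_zero)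
  qed
  have e2: "(LINT z|lborel. ?u2 z * dbar1 \<phi> z) = - (LINT w|lborel. g w * tconv ?k (\<lambda>t. - (0, t)) \<phi> w)"
    unfolding tconv_transpose[OF f2(1) k L(1) m M]
    by (rule weak_dbar1_partial_transpose[OF \<phi> D2 f2 g weak k])
  have e3: "(LINT z|lborel. ?u z * dbar1 \<phi> z) = pi * (LINT w|lborel. g w * tconv ?k (\<lambda>t. - (0, t)) \<phi> w)"
  proof -
    have "g w * tconv ?kk (\<lambda>t. - t) (dbar1 \<phi>) w = pi * (g w * tconv ?k (\<lambda>t. - (0, t)) \<phi> w)" for w
      using tconv_product_kernel_dbar1[OF \<phi> _ R, of "fst w" "snd w"] g(2)[of w]
      by (cases "w \<in> D1 \<times> D2") auto
    then show ?thesis unfolding tconv_transpose[OF g(1) kk L(3) m M] by (simp only: integral_mult_right_zero)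
  qed
  have "- (LINT z|lborel. cauchy_potential R f1 f2 g z * dbar1 \<phi> z) =
    (LINT z|lborel. (1 / pi) * (?u2 z * dbar1 \<phi> z) + (1 / pi) * (?u1 z * dbar1 \<phi> z) + (1 / pi\<^sup>2) * (?u z * dbar1 \<phi> z))"
    unfolding integral_minus[symmetric] cauchy_potential_def
    by (intro Bochner_Integration.integral_cong) (simp_all add: field_simps)
  also have "\<dots> = (1 / pi) * (LINT z|lborel. ?u2 z * dbar1 \<phi> z) + (1 / pi) * (LINT z|lborel. ?u1 z * dbar1 \<phi> z)
      + (1 / pi\<^sup>2) * (LINT z|lborel. ?u z * dbar1 \<phi> z)"
    using i by (simp del: times_divide_eq_left times_divide_eq_right)
  \<comment> \<open>The weights match: the f2 term brings -1/pi and the double term pi/pi^2, times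
    the same integral.\<close>
  also have "\<dots> = (LINT z|lborel. f1 z * \<phi> z)"
    unfolding e1 e2 e3 by (simp add: power2_eq_square)
  finally show ?thesis .
qed

section \<open>Exchange of the two variables\<close>

lemma borel_measurable_swap [measurable]:
  "prod.swap \<in> borel_measurable (borel :: ('a::euclidean_space \<times> 'b::euclidean_space) measure)"
  by (rule borel_measurable_continuous_onI) (auto simp: prod.swap_def intro!: continuous_intros)

lemma lborel_distr_swap: "distr lborel borel (prod.swap :: C2 \<Rightarrow> C2) = lborel"
proof -
  have "lborel = distr lborel lborel (\<lambda>z::C2. (snd z, fst z))"
    using lborel_pair.distr_pair_swap[where ?'a=complex and ?'b=complex]
    by (simp add: lborel_prod case_prod_unfold)
  also have "\<dots> = distr lborel borel prod.swap"
    by (rule distr_cong) (auto simp: prod.swap_def)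
  finally show ?thesis by simp
qed

lemma integral_lborel_swap:
  fixes f :: "C2 \<Rightarrow> complex"
  assumes [measurable]: "f \<in> borel_measurable borel"
  shows "(LINT z|lborel. f (prod.swap z)) = (LINT z|lborel. f z)"
  by (subst (2) lborel_distr_swap[symmetric]) (simp add: integral_distr)

lemma integrable_lborel_swap:
  fixes f :: "C2 \<Rightarrow> complex"
  assumes f: "integrable lborel f"
  shows "integrable lborel (\<lambda>z. f (prod.swap z))"
proof -
  have [measurable]: "f \<in> borel_measurable borel" using f by auto
  show ?thesis using f by (subst (asm) lborel_distr_swap[symmetric]) (simp add: integrable_distr_eq)
qed

lemma bounded_linear_swap: "bounded_linear (prod.swap :: 'a::real_normed_vector \<times> 'b::real_normed_vector \<Rightarrow> 'b \<times> 'a)"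
  unfolding prod.swap_def[abs_def] by (intro bounded_linear_Pair bounded_linear_snd bounded_linear_fst)

lemma test_functions_swap:
  assumes "\<phi> \<in> test_functions (D1 \<times> D2)"
  shows "(\<lambda>z. \<phi> (prod.swap z)) \<in> test_functions (D2 \<times> D1)"
proof (rule test_functionsI)
  let ?S = "closure {x. \<phi> x \<noteq> 0}"
  show "Ck k (\<lambda>z. \<phi> (prod.swap z))" for k
    using assms by (auto simp: test_functions_def intro: Ck_compose_linear[OF bounded_linear_swap])
  show "compact (prod.swap ` ?S)"
    using assms by (intro compact_continuous_image linear_continuous_on bounded_linear_swap) (auto simp: test_functions_def)
  show "prod.swap ` ?S \<subseteq> D2 \<times> D1" using assms by (auto simp: test_functions_def)
  show "z \<in> prod.swap ` ?S" if "\<phi> (prod.swap z) \<noteq> 0" for z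
    using that closure_subset[of "{x. \<phi> x \<noteq> 0}"] by (intro image_eqI[of _ _ "prod.swap z"]) auto
qed

lemma
  assumes "Ck (Suc k) \<phi>"
  shows dbar1_swap: "dbar1 (\<lambda>z. \<phi> (prod.swap z)) z = dbar2 \<phi> (prod.swap z)"
    and dbar2_swap: "dbar2 (\<lambda>z. \<phi> (prod.swap z)) z = dbar1 \<phi> (prod.swap z)"
proof -
  have "((\<lambda>z. \<phi> (prod.swap z)) has_derivative (\<lambda>v. frechet_derivative \<phi> (at (prod.swap z)) (prod.swap v))) (at z)"
    by (rule has_derivative_compose[OF bounded_linear_imp_has_derivative[OF bounded_linear_swap] Ck_SucD(1)[OF assms]])
  from frechet_derivative_at[OF this, symmetric]
  show "dbar1 (\<lambda>z. \<phi> (prod.swap z)) z = dbar2 \<phi> (prod.swap z)"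
    and "dbar2 (\<lambda>z. \<phi> (prod.swap z)) z = dbar1 \<phi> (prod.swap z)"
    by (simp_all add: dbar1_def dbar2_def)
qed

text \<open>The two single convolutions change places; the double one is preserved since its kernel
  is symmetric and Lebesgue measure is invariant under the swap.\<close>

lemma cauchy_potential_swap:
  assumes [measurable]: "g \<in> borel_measurable borel"
  shows "cauchy_potential R (\<lambda>z. f2 (prod.swap z)) (\<lambda>z. f1 (prod.swap z)) (\<lambda>z. g (prod.swap z)) z =
    cauchy_potential R f1 f2 g (prod.swap z)"
proof -
  have "(LINT t|lborel. g (prod.swap z + prod.swap t) * (cauchy_kernel R (snd (prod.swap t)) * cauchy_kernel R (fst (prod.swap t))))
    = (LINT t|lborel. g (prod.swap z + t) * (cauchy_kernel R (snd t) * cauchy_kernel R (fst t)))"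
    by (rule integral_lborel_swap[of "\<lambda>t. g (prod.swap z + t) * (cauchy_kernel R (snd t) * cauchy_kernel R (fst t))"]) measurable
  then show ?thesis
    by (cases z) (simp add: cauchy_potential_def tconv_def prod.swap_def mult.commute)
qed

lemma borel_measurable_cauchy_potential:
  assumes [measurable]: "f1 \<in> borel_measurable borel" "f2 \<in> borel_measurable borel" "g \<in> borel_measurable borel"
  shows "cauchy_potential R f1 f2 g \<in> borel_measurable borel"
proof -
  have L: "(\<lambda>t::complex. (0::complex, t)) \<in> borel_measurable borel"
    "(\<lambda>t::complex. (t, 0::complex)) \<in> borel_measurable borel" "(\<lambda>t::C2. t) \<in> borel_measurable borel" by measurable
  have kk: "(\<lambda>t::C2. cauchy_kernel R (fst t) * cauchy_kernel R (snd t)) \<in> borel_measurable borel"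
    by (intro borel_measurable_times borel_measurable_cauchy_kernel_fst borel_measurable_cauchy_kernel_snd)
  note m = borel_measurable_tconv[OF assms(2) borel_measurable_cauchy_kernel L(1)]
    borel_measurable_tconv[OF assms(1) borel_measurable_cauchy_kernel L(2)]
    borel_measurable_tconv[OF assms(3) kk L(3)]
  show ?thesis unfolding cauchy_potential_def[abs_def]
    by (intro borel_measurable_diff borel_measurable_uminus borel_measurable_divide borel_measurable_const m)
qed

lemma weak_dbar2_cauchy_potential:
  assumes D1: "open D1"
    and R: "\<And>a b. a \<in> D2 \<Longrightarrow> b \<in> D2 \<Longrightarrow> norm (a - b) < R"
    and f1: "integrable lborel f1" "\<And>z. z \<notin> D1 \<times> D2 \<Longrightarrow> f1 z = 0"
    and f2: "integrable lborel f2" "\<And>z. z \<notin> D1 \<times> D2 \<Longrightarrow> f2 z = 0"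
    and g: "integrable lborel g" "\<And>z. z \<notin> D1 \<times> D2 \<Longrightarrow> g z = 0"
    and weak: "\<And>\<theta>. \<theta> \<in> test_functions (D1 \<times> D2) \<Longrightarrow>
       - (LINT z|lborel. f1 z * dbar2 \<theta> z) = (LINT z|lborel. g z * \<theta> z)"
    and \<phi>: "\<phi> \<in> test_functions (D1 \<times> D2)"
  shows "- (LINT z|lborel. cauchy_potential R f1 f2 g z * dbar2 \<phi> z) = (LINT z|lborel. f2 z * \<phi> z)"
proof -
  let ?s = "prod.swap :: C2 \<Rightarrow> C2"
  have [measurable]: "f1 \<in> borel_measurable borel" "f2 \<in> borel_measurable borel" "g \<in> borel_measurable borel"
    using f1 f2 g by auto
  have [measurable]: "cauchy_potential R f1 f2 g \<in> borel_measurable borel"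
    by (rule borel_measurable_cauchy_potential) auto
  have CC: "Ck k \<theta>" if "\<theta> \<in> test_functions \<Omega>" for k \<Omega> and \<theta> :: "C2 \<Rightarrow> complex"
    using that by (simp add: test_functions_def)
  have m: "\<theta> \<in> borel_measurable borel" "dbar1 \<theta> \<in> borel_measurable borel" "dbar2 \<theta> \<in> borel_measurable borel"
    if "\<theta> \<in> test_functions \<Omega>" for \<Omega> and \<theta> :: "C2 \<Rightarrow> complex"
    by (intro borel_measurable_continuous_onI Ck_imp_continuous_on[of 0] Ck_dbar1 Ck_dbar2 CC[OF that])+
  have "- (LINT z|lborel. cauchy_potential R (\<lambda>z. f2 (?s z)) (\<lambda>z. f1 (?s z)) (\<lambda>z. g (?s z)) z * dbar1 (\<lambda>z. \<phi> (?s z)) z) =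
    (LINT z|lborel. f2 (?s z) * \<phi> (?s z))"
  proof (rule weak_dbar1_cauchy_potential[OF D1 R])
    show "integrable lborel (\<lambda>z. f2 (?s z))" "integrable lborel (\<lambda>z. f1 (?s z))" "integrable lborel (\<lambda>z. g (?s z))"
      by (intro integrable_lborel_swap f1 f2 g)+
    show "(\<lambda>z. \<phi> (?s z)) \<in> test_functions (D2 \<times> D1)" by (rule test_functions_swap[OF \<phi>])
  next
    fix \<theta> :: "C2 \<Rightarrow> complex" assume \<theta>: "\<theta> \<in> test_functions (D2 \<times> D1)"
    note [measurable] = m[OF \<theta>]
    have d: "dbar2 (\<lambda>z. \<theta> (?s z)) z = dbar1 \<theta> (?s z)" for z by (rule dbar2_swap[OF CC[OF \<theta>]])
    have "- (LINT z|lborel. f1 (?s z) * dbar1 \<theta> z) = - (LINT z|lborel. f1 z * dbar2 (\<lambda>z. \<theta> (?s z)) z)"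
      using integral_lborel_swap[of "\<lambda>z. f1 z * dbar1 \<theta> (?s z)"] unfolding d by simp
    also have "\<dots> = (LINT z|lborel. g z * \<theta> (?s z))" by (rule weak[OF test_functions_swap[OF \<theta>]])
    also have "\<dots> = (LINT z|lborel. g (?s z) * \<theta> z)"
      using integral_lborel_swap[of "\<lambda>z. g z * \<theta> (?s z)"] by simp
    finally show "- (LINT z|lborel. f1 (?s z) * dbar1 \<theta> z) = (LINT z|lborel. g (?s z) * \<theta> z)" .
  qed (auto intro!: f1 f2 g)
  moreover have "dbar1 (\<lambda>z. \<phi> (?s z)) z = dbar2 \<phi> (?s z)" for z by (rule dbar1_swap[OF CC[OF \<phi>]])
  moreover note [measurable] = m[OF \<phi>]
  ultimately show ?thesis
    using integral_lborel_swap[of "\<lambda>z. cauchy_potential R f1 f2 g z * dbar2 \<phi> z"]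
      integral_lborel_swap[of "\<lambda>z. f2 z * \<phi> z"]
    by (simp add: cauchy_potential_swap)
qed

section \<open>Lebesgue measurable data\<close>

text \<open>Completeness makes any \<open>F\<close> that agrees almost everywhere with a Borel
  function Lebesgue measurable. Through this lemma integrals of the given data and of
  \<open>T\<close> pass to Borel functions, where Fubini is available.\<close>

lemma lebesgue_AE_eq_borel:
  fixes F h :: "'a::euclidean_space \<Rightarrow> 'b::{banach, second_countable_topology}"
  assumes h: "h \<in> borel_measurable borel" and ae: "AE w in lborel. F w = h w"
  shows "F \<in> borel_measurable lebesgue"
    and "integrable lebesgue F \<longleftrightarrow> integrable lborel h"
    and "(LINT w|lebesgue. F w) = (LINT w|lborel. h w)"
proof -
  have ae': "AE w in lebesgue. F w = h w" using ae by (rule AE_completion)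
  have h': "h \<in> borel_measurable lebesgue" using h by (simp add: measurable_completion)
  show F: "F \<in> borel_measurable lebesgue"
  proof (rule measurableI)
    fix A :: "'b set" assume A: "A \<in> sets borel"
    have "h -` A \<inter> space lebesgue \<in> sets lebesgue" using measurable_sets[OF h' A] .
    then show "F -` A \<inter> space lebesgue \<in> sets lebesgue"
      by (rule completion.in_sets_AE[rotated]) (use ae' in \<open>auto elim!: eventually_mono\<close>)
  qed simp
  have "integrable lebesgue F \<longleftrightarrow> integrable lebesgue h" by (rule integrable_cong_AE[OF F h' ae'])
  also have "\<dots> \<longleftrightarrow> integrable lborel h" by (rule integrable_completion) (simp add: h)
  finally show "integrable lebesgue F \<longleftrightarrow> integrable lborel h" .
  have "(LINT w|lebesgue. F w) = (LINT w|lebesgue. h w)" by (rule integral_cong_AE[OF F h' ae'])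
  also have "\<dots> = (LINT w|lborel. h w)" by (rule integral_completion) (simp add: h)
  finally show "(LINT w|lebesgue. F w) = (LINT w|lborel. h w)" .
qed

text \<open>Vanishing off \<open>\<Omega>\<close> turns set integrals into integrals over all of
  space; the values of \<open>f\<close> off \<open>\<Omega>\<close> are arbitrary.\<close>

definition borel_version :: "'a::euclidean_space set \<Rightarrow> ('a \<Rightarrow> complex) \<Rightarrow> ('a \<Rightarrow> complex) \<Rightarrow> bool" where
  "borel_version \<Omega> f f' \<longleftrightarrow> f' \<in> borel_measurable borel \<and> (\<forall>z. z \<notin> \<Omega> \<longrightarrow> f' z = 0) \<and>
     (AE z in lborel. z \<in> \<Omega> \<longrightarrow> f z = f' z)"

lemma borel_version_exists:
  assumes f: "set_borel_measurable lebesgue \<Omega> f" and \<Omega>: "open \<Omega>"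
  obtains f' where "borel_version \<Omega> f f'"
proof -
  let ?f = "\<lambda>x. indicator \<Omega> x *\<^sub>R f x"
  have m: "?f \<in> borel_measurable lebesgue" using f by (simp add: set_borel_measurable_def)
  have re: "(\<lambda>x. Re (?f x)) \<in> borel_measurable lebesgue" and im: "(\<lambda>x. Im (?f x)) \<in> borel_measurable lebesgue"
    using m unfolding borel_measurable_complex_iff by auto
  from completion_ex_borel_measurable_real[OF re] obtain u
    where u: "u \<in> borel_measurable lborel" "AE x in lborel. Re (?f x) = u x" by blast
  from completion_ex_borel_measurable_real[OF im] obtain v
    where v: "v \<in> borel_measurable lborel" "AE x in lborel. Im (?f x) = v x" by blast
  have [measurable]: "u \<in> borel_measurable borel" "v \<in> borel_measurable borel" using u(1) v(1) by auto
  have [measurable]: "\<Omega> \<in> sets borel" using \<Omega> by auto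
  define f' where "f' x = indicator \<Omega> x *\<^sub>R (complex_of_real (u x) + \<i> * complex_of_real (v x))" for x
  have "f' \<in> borel_measurable borel" unfolding f'_def[abs_def] by measurable
  moreover have "AE z in lborel. z \<in> \<Omega> \<longrightarrow> f z = f' z"
    using u(2) v(2) by eventually_elim (auto simp: f'_def complex_eq_iff)
  ultimately have "borel_version \<Omega> f f'" by (auto simp: borel_version_def f'_def)
  then show ?thesis by (rule that)
qed

text \<open>L^p lies in L^1 on a bounded set, because |f'| is at most the indicator of
  \<open>\<Omega>\<close> plus |f'|^p.\<close>

lemma borel_version_Lp_integrable:
  assumes v: "borel_version \<Omega> f f'" and \<Omega>: "open \<Omega>" "bounded \<Omega>" and p: "1 \<le> p" and f: "f \<in> Lp \<Omega> p"
  shows "integrable lborel (\<lambda>z. norm (f' z) powr p)" "integrable lborel f'"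
    "(LINT z:\<Omega>|lebesgue. norm (f z) powr p) = (LINT z|lborel. norm (f' z) powr p)"
proof -
  have m[measurable]: "f' \<in> borel_measurable borel" using v by (simp add: borel_version_def)
  have ae: "AE z in lborel. indicator \<Omega> z *\<^sub>R (norm (f z) powr p) = norm (f' z) powr p"
    using v unfolding borel_version_def by (auto elim!: eventually_mono simp: indicator_def)
  have mp: "(\<lambda>z. norm (f' z) powr p) \<in> borel_measurable borel" by measurable
  note 1 = lebesgue_AE_eq_borel[OF mp ae]
  show int: "integrable lborel (\<lambda>z. norm (f' z) powr p)"
    using f 1(2) by (simp add: Lp_def set_integrable_def)
  show "(LINT z:\<Omega>|lebesgue. norm (f z) powr p) = (LINT z|lborel. norm (f' z) powr p)"
    using 1(3) by (simp add: set_lebesgue_integral_def)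
  have "integrable lborel (indicat_real \<Omega>)"
    using \<Omega> emeasure_bounded_finite[of \<Omega>] by (intro integrable_real_indicator) auto
  from Bochner_Integration.integrable_add[OF this int]
  show "integrable lborel f'"
  proof (rule Bochner_Integration.integrable_bound)
    show "AE z in lborel. norm (f' z) \<le> norm (indicat_real \<Omega> z + norm (f' z) powr p)"
    proof (rule AE_I2)
      fix z
      show "norm (f' z) \<le> norm (indicat_real \<Omega> z + norm (f' z) powr p)"
      proof (cases "z \<in> \<Omega>")
        case False then show ?thesis using v by (simp add: borel_version_def)
      next
        case True
        show ?thesis
        proof (cases "norm (f' z) \<le> 1")
          case True
          then show ?thesis using \<open>z \<in> \<Omega>\<close> by (simp add: add_increasing2)
        next
          case False
          then have "norm (f' z) powr 1 \<le> norm (f' z) powr p" using p by (intro powr_mono) auto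
          then show ?thesis using False by (simp add: add_increasing)
        qed
      qed
    qed
  qed simp
qed

lemma borel_version_regular_dist:
  assumes v: "borel_version \<Omega> f f'" and [measurable]: "\<theta> \<in> borel_measurable borel"
  shows "regular_dist \<Omega> f \<theta> = (LINT z|lborel. f' z * \<theta> z)"
proof -
  have [measurable]: "f' \<in> borel_measurable borel" using v by (simp add: borel_version_def)
  have ae: "AE z in lborel. indicator \<Omega> z *\<^sub>R (f z * \<theta> z) = f' z * \<theta> z"
    using v unfolding borel_version_def by (auto elim!: eventually_mono simp: indicator_def)
  have m: "(\<lambda>z. f' z * \<theta> z) \<in> borel_measurable borel" by measurable
  show ?thesis
    unfolding regular_dist_def set_lebesgue_integral_def by (rule lebesgue_AE_eq_borel(3)[OF m ae])
qed

section \<open>Null sets, slices, and the identification of \<open>T\<close> with the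
  potential\<close>

lemma AE_lborel_fst:
  assumes "AE x in (lborel :: 'a::euclidean_space measure). P x"
  shows "AE z in (lborel :: ('a \<times> 'b::euclidean_space) measure). P (fst z)"
proof -
  obtain N where N: "{x. \<not> P x} \<subseteq> N" "N \<in> null_sets (lborel :: 'a measure)"
    using assms by (auto simp: eventually_ae_filter)
  have "N \<times> UNIV \<in> null_sets (lborel \<Otimes>\<^sub>M lborel :: ('a \<times> 'b) measure)"
    using N(2) by (auto simp: null_sets_def lborel.emeasure_pair_measure_Times)
  then have "N \<times> UNIV \<in> null_sets (lborel :: ('a \<times> 'b) measure)" by (simp add: lborel_prod)
  then show ?thesis by (rule AE_I') (use N(1) in auto)
qed

lemma AE_lborel_snd:
  assumes "AE x in (lborel :: 'b::euclidean_space measure). P x"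
  shows "AE z in (lborel :: ('a::euclidean_space \<times> 'b) measure). P (snd z)"
proof -
  obtain N where N: "{x. \<not> P x} \<subseteq> N" "N \<in> null_sets (lborel :: 'b measure)"
    using assms by (auto simp: eventually_ae_filter)
  have "UNIV \<times> N \<in> null_sets (lborel \<Otimes>\<^sub>M lborel :: ('a \<times> 'b) measure)"
    using N(2) by (auto simp: null_sets_def lborel.emeasure_pair_measure_Times)
  then have "UNIV \<times> N \<in> null_sets (lborel :: ('a \<times> 'b) measure)" by (simp add: lborel_prod)
  then show ?thesis by (rule AE_I') (use N(1) in auto)
qed

text \<open>Fubini for null sets. The outer quantifier ranges over pairs, not over one coordinate,
  so that these facts combine with other almost-everywhere statements about
  \<open>z\<close>.\<close>

lemma AE_lborel_slices:
  fixes P :: "C2 \<Rightarrow> bool"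
  assumes "AE z in lborel. P z"
  shows "AE z in lborel. AE w in lborel. P (fst z, w)" and "AE z in lborel. AE w in lborel. P (w, snd z)"
proof -
  have "AE z in lborel \<Otimes>\<^sub>M lborel. P z" using assms by (subst lborel_prod)
  from lborel_pair.AE_pair[OF this] show "AE z in lborel. AE w in lborel. P (fst z, w)"
    by (rule AE_lborel_fst)
  have "AE z in lborel. P (prod.swap z)"
  proof -
    have "AE z in distr lborel borel (prod.swap :: C2 \<Rightarrow> C2). P z" using assms by (subst lborel_distr_swap)
    then show ?thesis by (rule AE_distrD[rotated]) simp
  qed
  then have "AE z in lborel \<Otimes>\<^sub>M lborel. P (prod.swap z)" by (subst lborel_prod)
  from lborel_pair.AE_pair[OF this] show "AE z in lborel. AE w in lborel. P (w, snd z)"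
    by (intro AE_lborel_snd[where P="\<lambda>x. AE w in lborel. P (w, x)"]) simp
qed

text \<open>For \<open>w\<close> and \<open>z\<close> in \<open>D\<close> the cut-off kernel at w -
  z is 1/(w - z), both being 0 at \<open>w = z\<close> by division by zero; then t = w - z is
  substituted.\<close>

lemma set_integral_cauchy_kernel_slice:
  fixes F h :: "complex \<Rightarrow> complex"
  assumes h[measurable]: "h \<in> borel_measurable borel" "\<And>w. w \<notin> D \<Longrightarrow> h w = 0"
    and ae: "AE w in lborel. w \<in> D \<longrightarrow> F w = h w"
    and R: "\<And>a b. a \<in> D \<Longrightarrow> b \<in> D \<Longrightarrow> norm (a - b) < R" and z: "z \<in> D"
    and int: "integrable lborel (\<lambda>t. h (z + t) * cauchy_kernel R t)"
  shows "set_integrable lebesgue D (\<lambda>w. F w / (w - z))"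
    and "(LINT w:D|lebesgue. F w / (w - z)) = (LINT t|lborel. h (z + t) * cauchy_kernel R t)"
proof -
  let ?G = "\<lambda>w. h w * cauchy_kernel R (w - z)"
  have ae': "AE w in lborel. indicator D w *\<^sub>R (F w / (w - z)) = ?G w"
    using ae
  proof eventually_elim
    case (elim w)
    then show ?case using R[of w z] z h(2)[of w] by (cases "w \<in> D") (auto simp: cauchy_kernel_def)
  qed
  have m: "?G \<in> borel_measurable borel" by measurable
  have "integrable lborel ?G"
    using integrable_lborel_translate[OF int, of "- z"] by (simp add: algebra_simps)
  then show "set_integrable lebesgue D (\<lambda>w. F w / (w - z))"
    using lebesgue_AE_eq_borel(2)[OF m ae'] by (simp add: set_integrable_def)
  have "(LINT w:D|lebesgue. F w / (w - z)) = (LINT w|lborel. ?G w)"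
    using lebesgue_AE_eq_borel(3)[OF m ae'] by (simp add: set_lebesgue_integral_def)
  also have "\<dots> = (LINT t|lborel. h (z + t) * cauchy_kernel R t)"
    using integral_lborel_translate[OF m, of z] by (simp add: add.commute)
  finally show "(LINT w:D|lebesgue. F w / (w - z)) = (LINT t|lborel. h (z + t) * cauchy_kernel R t)" .
qed

lemma set_integral_product_kernel:
  fixes F h :: "C2 \<Rightarrow> complex"
  assumes h[measurable]: "h \<in> borel_measurable borel" "\<And>w. w \<notin> D1 \<times> D2 \<Longrightarrow> h w = 0"
    and ae: "AE w in lborel. w \<in> D1 \<times> D2 \<longrightarrow> F w = h w"
    and R: "\<And>a b. a \<in> D1 \<Longrightarrow> b \<in> D1 \<Longrightarrow> norm (a - b) < R" "\<And>a b. a \<in> D2 \<Longrightarrow> b \<in> D2 \<Longrightarrow> norm (a - b) < R"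
    and z: "(z1, z2) \<in> D1 \<times> D2"
    and int: "integrable lborel (\<lambda>t. h ((z1, z2) + t) * (cauchy_kernel R (fst t) * cauchy_kernel R (snd t)))"
  shows "set_integrable lebesgue (D1 \<times> D2) (\<lambda>w. F w / ((fst w - z1) * (snd w - z2)))"
    and "(LINT w:(D1 \<times> D2)|lebesgue. F w / ((fst w - z1) * (snd w - z2))) =
      (LINT t|lborel. h ((z1, z2) + t) * (cauchy_kernel R (fst t) * cauchy_kernel R (snd t)))"
proof -
  let ?k = "\<lambda>t. cauchy_kernel R (fst t) * cauchy_kernel R (snd t)"
  let ?G = "\<lambda>w. h w * ?k (w - (z1, z2))"
  have ae': "AE w in lborel. indicator (D1 \<times> D2) w *\<^sub>R (F w / ((fst w - z1) * (snd w - z2))) = ?G w"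
    using ae
  proof eventually_elim
    case (elim w)
    then show ?case using R(1)[of "fst w" z1] R(2)[of "snd w" z2] z h(2)[of w]
      by (cases "w \<in> D1 \<times> D2") (auto simp: cauchy_kernel_def)
  qed
  have k: "?k \<in> borel_measurable borel"
    by (intro borel_measurable_times borel_measurable_cauchy_kernel_fst borel_measurable_cauchy_kernel_snd)
  have "(\<lambda>w. ?k (w - (z1, z2))) \<in> borel_measurable borel"
    by (rule measurable_compose[OF _ k]) measurable
  from borel_measurable_times[OF h(1) this] have m: "?G \<in> borel_measurable borel" .
  have "integrable lborel ?G"
  proof -
    have "(z1, z2) + (w + - (z1, z2)) = w" "w + - (z1, z2) = w - (z1, z2)" for w :: C2
      by (auto simp: prod_eq_iff)
    then show ?thesis using integrable_lborel_translate[OF int, of "- (z1, z2)"] by (simp only:)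
  qed
  then show "set_integrable lebesgue (D1 \<times> D2) (\<lambda>w. F w / ((fst w - z1) * (snd w - z2)))"
    using lebesgue_AE_eq_borel(2)[OF m ae'] by (simp add: set_integrable_def)
  have "(LINT w:(D1 \<times> D2)|lebesgue. F w / ((fst w - z1) * (snd w - z2))) = (LINT w|lborel. ?G w)"
    using lebesgue_AE_eq_borel(3)[OF m ae'] by (simp add: set_lebesgue_integral_def)
  also have "\<dots> = (LINT t|lborel. h ((z1, z2) + t) * ?k t)"
    using integral_lborel_translate[OF m, of "(z1, z2)"] by (simp add: add.commute)
  finally show "(LINT w:(D1 \<times> D2)|lebesgue. F w / ((fst w - z1) * (snd w - z2))) =
      (LINT t|lborel. h ((z1, z2) + t) * ?k t)" .
qed

lemma T_eq_cauchy_potential_AE: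
  assumes v1: "borel_version (D1 \<times> D2) (fst f) f1" and v2: "borel_version (D1 \<times> D2) (snd f) f2"
    and vg: "borel_version (D1 \<times> D2) g g'"
    and i: "integrable lborel f1" "integrable lborel f2" "integrable lborel g'"
    and R: "\<And>a b. a \<in> D1 \<Longrightarrow> b \<in> D1 \<Longrightarrow> norm (a - b) < R" "\<And>a b. a \<in> D2 \<Longrightarrow> b \<in> D2 \<Longrightarrow> norm (a - b) < R"
  shows "AE z in lborel. z \<in> D1 \<times> D2 \<longrightarrow>
    T_converges_at D1 D2 f g z \<and> T D1 D2 f g z = cauchy_potential R f1 f2 g' z"
proof -
  let ?k = "cauchy_kernel R" and ?kk = "\<lambda>t. cauchy_kernel R (fst t) * cauchy_kernel R (snd t)"
  have [measurable]: "f1 \<in> borel_measurable borel" "f2 \<in> borel_measurable borel" "g' \<in> borel_measurable borel"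
    using i by auto
  have z1: "f1 z = 0" and z2: "f2 z = 0" and zg: "g' z = 0" if "z \<notin> D1 \<times> D2" for z
    using v1 v2 vg that by (auto simp only: borel_version_def)
  have a1: "AE z in lborel. z \<in> D1 \<times> D2 \<longrightarrow> fst f z = f1 z"
    and a2: "AE z in lborel. z \<in> D1 \<times> D2 \<longrightarrow> snd f z = f2 z"
    and ag: "AE z in lborel. z \<in> D1 \<times> D2 \<longrightarrow> g z = g' z"
    using v1 v2 vg by (auto simp: borel_version_def)
  have L: "(\<lambda>t::complex. (0::complex, t)) \<in> borel_measurable borel"
    "(\<lambda>t::complex. (t, 0::complex)) \<in> borel_measurable borel" "(\<lambda>t::C2. t) \<in> borel_measurable borel" by measurable
  show ?thesis
    \<comment> \<open>Five exceptional null sets: two where a slice of the data differs from that of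
      its Borel version on a non-null set, three where a convolution integral diverges.\<close>
    using AE_lborel_slices(1)[OF a2] AE_lborel_slices(2)[OF a1]
      AE_integrable_tconv[OF i(1) integrable_cauchy_kernel[of R] L(2)]
      AE_integrable_tconv[OF i(2) integrable_cauchy_kernel[of R] L(1)]
      AE_integrable_tconv[OF i(3) integrable_product_kernel[of R] L(3)]
  proof eventually_elim
    case (elim z)
    show ?case
    proof
      assume zD: "z \<in> D1 \<times> D2"
      obtain x y where z: "z = (x, y)" by (cases z)
      have xy: "x \<in> D1" "y \<in> D2" using zD z by auto
      have m2: "(\<lambda>w. f2 (x, w)) \<in> borel_measurable borel" and m1: "(\<lambda>w. f1 (w, y)) \<in> borel_measurable borel"
        by measurable
      have s2: "AE w in lborel. w \<in> D2 \<longrightarrow> snd f (x, w) = f2 (x, w)"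
        and s1: "AE w in lborel. w \<in> D1 \<longrightarrow> fst f (w, y) = f1 (w, y)"
        using elim(1,2) xy by (auto simp: z)
      have n2: "f2 (x, w) = 0" if "w \<notin> D2" for w using that by (intro z2) auto
      have n1: "f1 (w, y) = 0" if "w \<notin> D1" for w using that by (intro z1) auto
      have int2: "integrable lborel (\<lambda>t. f2 (x, y + t) * ?k t)" and int1: "integrable lborel (\<lambda>t. f1 (x + t, y) * ?k t)"
        and intg: "integrable lborel (\<lambda>t. g' ((x, y) + t) * ?kk t)"
        using elim(3-5) by (auto simp: z)
      note S2 = set_integral_cauchy_kernel_slice[OF m2 n2 s2 R(2) xy(2) int2]
      note S1 = set_integral_cauchy_kernel_slice[OF m1 n1 s1 R(1) xy(1) int1]
      have S2': "(LINT w:D2|lebesgue. snd f (x, w) / (w - y)) = (LINT t|lborel. f2 (x, y + t) * ?k t)" by (rule S2(2))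
      have S1': "(LINT w:D1|lebesgue. fst f (w, y) / (w - x)) = (LINT t|lborel. f1 (x + t, y) * ?k t)" by (rule S1(2))
      note Sg = set_integral_product_kernel[OF _ zg ag R _ intg]
      have Sg': "set_integrable lebesgue (D1 \<times> D2) (\<lambda>w. g w / ((fst w - x) * (snd w - y)))"
        "(LINT w:(D1 \<times> D2)|lebesgue. g w / ((fst w - x) * (snd w - y))) = (LINT t|lborel. g' ((x, y) + t) * ?kk t)"
        using xy by (auto intro!: Sg)
      have c1: "- 1 / (2 * of_real pi * \<i>) * (2 * \<i> * X) = - (X / pi)" for X
        by (simp add: field_simps)
      have c2: "- 1 / (2 * of_real pi * \<i>)\<^sup>2 * ((2 * \<i>)\<^sup>2 * X) = - (X / pi\<^sup>2)" for X
        by (simp add: power_mult_distrib)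
      have "T D1 D2 f g z = cauchy_potential R f1 f2 g' z"
        unfolding z T_def case_prod_conv S1' S2' Sg'(2) c1 c2 cauchy_potential_def tconv_def by simp
      moreover have "T_converges_at D1 D2 f g z"
        unfolding z T_converges_at_def case_prod_conv using S1(1) S2(1) Sg'(1) by simp
      ultimately show "T_converges_at D1 D2 f g z \<and> T D1 D2 f g z = cauchy_potential R f1 f2 g' z" by simp
    qed
  qed
qed

section \<open>The L^p bound and the assembly of the theorem\<close>

text \<open>The sum is at most three times the maximum. This needs no convexity, so it serves for
  the exponent \<open>p\<close> and later for 1/p.\<close>

lemma powr_sum3_le:
  fixes a b c p :: real
  assumes "0 \<le> a" "0 \<le> b" "0 \<le> c" "0 \<le> p"
  shows "(a + b + c) powr p \<le> 3 powr p * (a powr p + b powr p + c powr p)"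
proof -
  define m where "m = max a (max b c)"
  have "(a + b + c) powr p \<le> (3 * m) powr p"
    using assms by (intro powr_mono2) (auto simp: m_def)
  also have "\<dots> = 3 powr p * m powr p" using assms by (intro powr_mult) 
  also have "m powr p \<le> a powr p + b powr p + c powr p"
    by (auto simp: m_def max_def)
  finally show ?thesis by simp
qed

text \<open>Young's inequality for each of the three terms. The factors 1/pi and 1/pi^2 are at most
  1 and are dropped; a single \<open>M\<close> bounds both kernel norms.\<close>

lemma cauchy_potential_Lp:
  assumes p: "1 \<le> p"
    and i: "integrable lborel f1" "integrable lborel f2" "integrable lborel g"
    and ip: "integrable lborel (\<lambda>z. norm (f1 z) powr p)" "integrable lborel (\<lambda>z. norm (f2 z) powr p)"
      "integrable lborel (\<lambda>z. norm (g z) powr p)"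
    and M: "(LINT t|lborel. norm (cauchy_kernel R t)) \<le> M"
      "(LINT t|lborel. norm (cauchy_kernel R (fst t) * cauchy_kernel R (snd t))) \<le> M"
  shows "integrable lborel (\<lambda>z. norm (cauchy_potential R f1 f2 g z) powr p)"
    and "(LINT z|lborel. norm (cauchy_potential R f1 f2 g z) powr p) \<le> (3 * M) powr p *
      ((LINT z|lborel. norm (f1 z) powr p) + (LINT z|lborel. norm (f2 z) powr p) + (LINT z|lborel. norm (g z) powr p))"
proof -
  let ?k = "cauchy_kernel R" and ?kk = "\<lambda>t. cauchy_kernel R (fst t) * cauchy_kernel R (snd t)"
  let ?u2 = "tconv ?k (\<lambda>t. (0, t)) f2" and ?u1 = "tconv ?k (\<lambda>t. (t, 0)) f1" and ?u = "tconv ?kk (\<lambda>t. t) g"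
  have m: "f1 \<in> borel_measurable borel" "f2 \<in> borel_measurable borel" "g \<in> borel_measurable borel"
    using i by auto
  have L: "(\<lambda>t::complex. (0::complex, t)) \<in> borel_measurable borel"
    "(\<lambda>t::complex. (t, 0::complex)) \<in> borel_measurable borel" "(\<lambda>t::C2. t) \<in> borel_measurable borel" by measurable
  note u1 = tconv_Lp[OF p m(1) ip(1) integrable_cauchy_kernel[of R] L(2)]
  note u2 = tconv_Lp[OF p m(2) ip(2) integrable_cauchy_kernel[of R] L(1)]
  note u = tconv_Lp[OF p m(3) ip(3) integrable_product_kernel[of R] L(3)]
  have A0: "0 \<le> (LINT t|lborel. norm (?k t))" "0 \<le> (LINT t|lborel. norm (?kk t))" by auto
  have M0: "0 \<le> M" using A0 M by linarith
  let ?B = "\<lambda>z. 3 powr p * (norm (?u2 z) powr p + norm (?u1 z) powr p + norm (?u z) powr p)"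
  have B_int: "integrable lborel ?B" using u1(1) u2(1) u(1) by auto
  have le: "norm (cauchy_potential R f1 f2 g z) powr p \<le> ?B z" for z
  proof -
    have pi1: "1 \<le> pi" using pi_gt3 by simp
    then have pi2: "1 \<le> pi\<^sup>2" by simp
    have d: "norm (X / complex_of_real q) \<le> norm X" if "1 \<le> q" for X q
    proof -
      have "norm X * 1 \<le> norm X * q" using that by (intro mult_left_mono) auto
      then show ?thesis using that by (simp add: norm_divide divide_le_eq)
    qed
    have "norm (cauchy_potential R f1 f2 g z) \<le> norm (?u2 z / pi) + norm (?u1 z / pi) + norm (?u z / complex_of_real (pi\<^sup>2))"
      unfolding cauchy_potential_def using norm_triangle_ineq4 norm_minus_cancel
      by (smt (verit) of_real_power)
    also have "\<dots> \<le> norm (?u2 z) + norm (?u1 z) + norm (?u z)"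
      by (intro add_mono d pi1 pi2)
    finally have "norm (cauchy_potential R f1 f2 g z) powr p \<le> (norm (?u2 z) + norm (?u1 z) + norm (?u z)) powr p"
      using p by (intro powr_mono2) auto
    also have "\<dots> \<le> ?B z" using p by (intro powr_sum3_le) auto
    finally show ?thesis .
  qed
  have mu: "cauchy_potential R f1 f2 g \<in> borel_measurable borel" by (rule borel_measurable_cauchy_potential[OF m])
  show int: "integrable lborel (\<lambda>z. norm (cauchy_potential R f1 f2 g z) powr p)"
  proof (rule Bochner_Integration.integrable_bound[OF B_int])
    show "(\<lambda>z. norm (cauchy_potential R f1 f2 g z) powr p) \<in> borel_measurable lborel" using mu by simp
    show "AE z in lborel. norm (norm (cauchy_potential R f1 f2 g z) powr p) \<le> norm (?B z)"
    proof (rule AE_I2)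
      fix z
      have "norm (norm (cauchy_potential R f1 f2 g z) powr p) = norm (cauchy_potential R f1 f2 g z) powr p" by simp
      also have "\<dots> \<le> ?B z" by (rule le)
      also have "\<dots> \<le> norm (?B z)" by simp
      finally show "norm (norm (cauchy_potential R f1 f2 g z) powr p) \<le> norm (?B z)" .
    qed
  qed
  have s: "(LINT z|lborel. norm (v z) powr p) \<le> M powr p * N"
    if "(LINT z|lborel. norm (v z) powr p) \<le> A powr p * N" "0 \<le> A" "A \<le> M" "0 \<le> N" for A N :: real and v :: "C2 \<Rightarrow> complex"
    using that p by (elim order_trans) (intro mult_right_mono powr_mono2, auto)
  have "(LINT z|lborel. norm (cauchy_potential R f1 f2 g z) powr p) \<le> (LINT z|lborel. ?B z)"
    by (intro integral_mono int B_int le)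
  also have "\<dots> = 3 powr p * ((LINT z|lborel. norm (?u2 z) powr p) + (LINT z|lborel. norm (?u1 z) powr p) + (LINT z|lborel. norm (?u z) powr p))"
    using u1(1) u2(1) u(1) by simp
  also have "\<dots> \<le> 3 powr p * (M powr p * (LINT z|lborel. norm (f2 z) powr p) + M powr p * (LINT z|lborel. norm (f1 z) powr p)
      + M powr p * (LINT z|lborel. norm (g z) powr p))"
    by (intro mult_left_mono add_mono s[OF u1(2) A0(1) M(1)] s[OF u2(2) A0(1) M(1)] s[OF u(2) A0(2) M(2)]) auto
  also have "\<dots> = (3 * M) powr p * ((LINT z|lborel. norm (f1 z) powr p) + (LINT z|lborel. norm (f2 z) powr p) + (LINT z|lborel. norm (g z) powr p))"
    using M0 by (simp add: powr_mult algebra_simps)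
  finally show "(LINT z|lborel. norm (cauchy_potential R f1 f2 g z) powr p) \<le> (3 * M) powr p *
      ((LINT z|lborel. norm (f1 z) powr p) + (LINT z|lborel. norm (f2 z) powr p) + (LINT z|lborel. norm (g z) powr p))" .
qed

theorem theorem3p4:
  fixes D1 D2 :: "complex set" and p :: real
  assumes "bounded_C1_domain D1" and "bounded_C1_domain D2" and "1 \<le> p"
  shows "\<exists>C>0. \<forall>(f :: form01) (g :: C2 \<Rightarrow> complex).
           weakly_dbar_closed (D1 \<times> D2) f \<and> f \<in> B_space (D1 \<times> D2) p \<and>
           represents_DD (D1 \<times> D2) p f g \<longrightarrow>
             (AE z in lebesgue. z \<in> D1 \<times> D2 \<longrightarrow> T_converges_at D1 D2 f g z) \<and>
             T D1 D2 f g \<in> Lp (D1 \<times> D2) p \<and>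
             weak_dbar_solution (D1 \<times> D2) f (T D1 D2 f g) \<and>
             Lp_norm (D1 \<times> D2) p (T D1 D2 f g) \<le> C * B_norm (D1 \<times> D2) p f g"
proof -
  let ?\<Omega> = "D1 \<times> D2"
  have D: "open D1" "open D2" "bounded D1" "bounded D2" using assms by (auto simp: bounded_C1_domain_def)
  have \<Omega>: "open ?\<Omega>" "bounded ?\<Omega>" using D by (auto intro: open_Times bounded_Times)
  have \<Omega>_sets[measurable]: "?\<Omega> \<in> sets borel" using \<Omega> by auto
  obtain R where R: "\<And>a b. a \<in> D1 \<Longrightarrow> b \<in> D1 \<Longrightarrow> norm (a - b) < R" "\<And>a b. a \<in> D2 \<Longrightarrow> b \<in> D2 \<Longrightarrow> norm (a - b) < R"
  proof -
    obtain r where r: "\<And>a. a \<in> D1 \<union> D2 \<Longrightarrow> norm a \<le> r"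
      using bounded_Un[of D1 D2] D unfolding bounded_iff by metis
    have "norm (a - b) < 2 * r + 1" if "a \<in> D1 \<union> D2" "b \<in> D1 \<union> D2" for a b
      using norm_triangle_ineq4[of a b] r[OF that(1)] r[OF that(2)] by linarith
    then show ?thesis using that[of "2 * r + 1"] by blast
  qed
  define A where "A = (LINT t|lborel. norm (cauchy_kernel R t))"
  define A' where "A' = (LINT t|lborel. norm (cauchy_kernel R (fst t) * cauchy_kernel R (snd t)))"
  \<comment> \<open>The summand 1 makes \<open>M\<close>, and hence the final constant,
    positive.\<close>
  define M where "M = A + A' + 1"
  have AA: "0 \<le> A" "0 \<le> A'" unfolding A_def A'_def by auto
  then have M: "0 < M" "A \<le> M" "A' \<le> M" by (auto simp: M_def)
  show ?thesis
  \<comment> \<open>One factor 3 comes from splitting the p-th power of the potential into three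
    terms, the other from splitting the 1/p-th power of the sum of three integrals. \<open>M\<close>
    depends only on \<open>R\<close>.\<close>
  proof (intro exI[of _ "9 * M"] conjI allI impI)
    show "0 < 9 * M" using M by simp
    fix f :: form01 and g :: "C2 \<Rightarrow> complex"
    assume H: "weakly_dbar_closed ?\<Omega> f \<and> f \<in> B_space ?\<Omega> p \<and> represents_DD ?\<Omega> p f g"
    then have Lp: "fst f \<in> Lp ?\<Omega> p" "snd f \<in> Lp ?\<Omega> p" "g \<in> Lp ?\<Omega> p"
      by (auto simp: B_space_def represents_DD_def)
    obtain f1 where v1: "borel_version ?\<Omega> (fst f) f1"
      by (rule borel_version_exists[OF _ \<Omega>(1)]) (use Lp(1) in \<open>auto simp: Lp_def\<close>)
    obtain f2 where v2: "borel_version ?\<Omega> (snd f) f2"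
      by (rule borel_version_exists[OF _ \<Omega>(1)]) (use Lp(2) in \<open>auto simp: Lp_def\<close>)
    obtain g' where vg: "borel_version ?\<Omega> g g'"
      by (rule borel_version_exists[OF _ \<Omega>(1)]) (use Lp(3) in \<open>auto simp: Lp_def\<close>)
    note i1 = borel_version_Lp_integrable[OF v1 \<Omega> assms(3) Lp(1)]
      and i2 = borel_version_Lp_integrable[OF v2 \<Omega> assms(3) Lp(2)]
      and ig = borel_version_Lp_integrable[OF vg \<Omega> assms(3) Lp(3)]
    have z: "f1 w = 0" "f2 w = 0" "g' w = 0" if "w \<notin> ?\<Omega>" for w
      using v1 v2 vg that by (auto simp only: borel_version_def)
    define u where "u = cauchy_potential R f1 f2 g'"
    have um[measurable]: "u \<in> borel_measurable borel"
      unfolding u_def by (rule borel_measurable_cauchy_potential) (use i1 i2 ig in auto)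
    have ae: "AE z in lborel. z \<in> ?\<Omega> \<longrightarrow> T_converges_at D1 D2 f g z \<and> T D1 D2 f g z = u z"
      unfolding u_def by (rule T_eq_cauchy_potential_AE[OF v1 v2 vg i1(2) i2(2) ig(2) R])
    show "AE z in lebesgue. z \<in> ?\<Omega> \<longrightarrow> T_converges_at D1 D2 f g z"
      by (rule AE_completion) (use ae in \<open>auto elim!: eventually_mono\<close>)
    \<comment> \<open>The potential does not vanish off the product in general; truncating it gives
      a Borel version of \<open>T D1 D2 f g\<close>, to which the lemmas on data then apply.\<close>
    define u' where "u' z = indicator ?\<Omega> z *\<^sub>R u z" for z
    have vu: "borel_version ?\<Omega> (T D1 D2 f g) u'"
      unfolding borel_version_def u'_def[abs_def] using ae by (auto elim!: eventually_mono)
    have u'm: "u' \<in> borel_measurable borel" using vu by (simp add: borel_version_def)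
    have uLp: "integrable lborel (\<lambda>z. norm (u z) powr p)"
      "(LINT z|lborel. norm (u z) powr p) \<le> (3 * M) powr p *
      ((LINT z|lborel. norm (f1 z) powr p) + (LINT z|lborel. norm (f2 z) powr p) + (LINT z|lborel. norm (g' z) powr p))"
      unfolding u_def
      by (rule cauchy_potential_Lp[OF assms(3) i1(2) i2(2) ig(2) i1(1) i2(1) ig(1) M(2,3)[unfolded A_def A'_def]])+
    have u'int: "integrable lborel (\<lambda>z. norm (u' z) powr p)"
      by (rule Bochner_Integration.integrable_bound[OF uLp(1)]) (use u'm in \<open>auto simp: u'_def indicator_def\<close>)
    have "AE z in lborel. indicator ?\<Omega> z *\<^sub>R T D1 D2 f g z = u' z"
      using vu unfolding borel_version_def by (auto elim!: eventually_mono simp: indicator_def)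
    from lebesgue_AE_eq_borel(1)[OF u'm this]
    have sm: "set_borel_measurable lebesgue ?\<Omega> (T D1 D2 f g)" by (simp add: set_borel_measurable_def)
    have ae': "AE z in lborel. indicator ?\<Omega> z *\<^sub>R (norm (T D1 D2 f g z) powr p) = norm (u' z) powr p"
      using vu unfolding borel_version_def by (auto elim!: eventually_mono simp: indicator_def)
    have u'pm: "(\<lambda>z. norm (u' z) powr p) \<in> borel_measurable borel" using u'm by simp
    note T_int = lebesgue_AE_eq_borel[OF u'pm ae']
    show "T D1 D2 f g \<in> Lp ?\<Omega> p"
      using sm T_int(2) u'int by (simp add: Lp_def set_integrable_def)
    have Ck: "Ck k \<phi>" if "\<phi> \<in> test_functions ?\<Omega>" for k and \<phi> :: "C2 \<Rightarrow> complex"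
      using that by (simp add: test_functions_def)
    have tm: "\<phi> \<in> borel_measurable borel" "dbar1 \<phi> \<in> borel_measurable borel" "dbar2 \<phi> \<in> borel_measurable borel"
      if "\<phi> \<in> test_functions ?\<Omega>" for \<phi> :: "C2 \<Rightarrow> complex"
      by (intro borel_measurable_continuous_onI Ck_imp_continuous_on[of 0] Ck_dbar1 Ck_dbar2 Ck[OF that])+
    \<comment> \<open>Closedness equates the two derivatives and \<open>g\<close> represents their
      average, so each of them is \<open>g\<close>.\<close>
    have weak2: "- (LINT z|lborel. f2 z * dbar1 \<theta> z) = (LINT z|lborel. g' z * \<theta> z)"
      and weak1: "- (LINT z|lborel. f1 z * dbar2 \<theta> z) = (LINT z|lborel. g' z * \<theta> z)"
      if \<theta>: "\<theta> \<in> test_functions ?\<Omega>" for \<theta> :: "C2 \<Rightarrow> complex"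
    proof -
      note r = borel_version_regular_dist[OF v1 tm(3)[OF \<theta>]] borel_version_regular_dist[OF v2 tm(2)[OF \<theta>]]
        borel_version_regular_dist[OF vg tm(1)[OF \<theta>]]
      have "- (LINT z|lborel. f1 z * dbar2 \<theta> z) = - (LINT z|lborel. f2 z * dbar1 \<theta> z)"
        using H \<theta> unfolding weakly_dbar_closed_def dist_eq_def dist_dbar1_def dist_dbar2_def r[symmetric] by blast
      moreover have "1 / 2 * (- (LINT z|lborel. f1 z * dbar2 \<theta> z) + - (LINT z|lborel. f2 z * dbar1 \<theta> z)) = (LINT z|lborel. g' z * \<theta> z)"
        using H \<theta> unfolding represents_DD_def DD_def dist_eq_def dist_dbar1_def dist_dbar2_def r[symmetric] by blast
      ultimately show "- (LINT z|lborel. f2 z * dbar1 \<theta> z) = (LINT z|lborel. g' z * \<theta> z)"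
        and "- (LINT z|lborel. f1 z * dbar2 \<theta> z) = (LINT z|lborel. g' z * \<theta> z)"
        by (simp_all add: field_simps)
    qed
    have off: "dbar1 \<phi> z = 0" "dbar2 \<phi> z = 0" if \<phi>: "\<phi> \<in> test_functions ?\<Omega>" and "z \<notin> ?\<Omega>" for \<phi> z
    proof -
      have "z \<notin> closure {x. \<phi> x \<noteq> 0}" using that by (auto simp: test_functions_def)
      then have "frechet_derivative \<phi> (at z) v = 0" for v
        by (rule has_derivative_zero_off_support[OF Ck_SucD(1)[OF Ck[OF \<phi>]]])
      then show "dbar1 \<phi> z = 0" "dbar2 \<phi> z = 0" by (simp_all add: dbar1_def dbar2_def)
    qed
    show "weak_dbar_solution ?\<Omega> f (T D1 D2 f g)"
      unfolding weak_dbar_solution_def dist_eq_def dist_dbar1_def dist_dbar2_def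
    proof (intro conjI ballI)
      fix \<phi> assume \<phi>: "\<phi> \<in> test_functions ?\<Omega>"
      \<comment> \<open>The derivatives of \<open>\<phi>\<close> vanish off the product, so the
        truncation is not seen and the weak equations of the untruncated potential apply.\<close>
      have o: "u' z * dbar1 \<phi> z = u z * dbar1 \<phi> z" "u' z * dbar2 \<phi> z = u z * dbar2 \<phi> z" for z
        using off[OF \<phi>, of z] by (cases "z \<in> ?\<Omega>"; simp add: u'_def)+
      show "- regular_dist ?\<Omega> (T D1 D2 f g) (dbar1 \<phi>) = regular_dist ?\<Omega> (fst f) \<phi>"
        unfolding borel_version_regular_dist[OF vu tm(2)[OF \<phi>]] borel_version_regular_dist[OF v1 tm(1)[OF \<phi>]] o
        unfolding u_def
        by (rule weak_dbar1_cauchy_potential[OF D(2) R(1) i1(2) z(1) i2(2) z(2) ig(2) z(3) weak2 \<phi>])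
      show "- regular_dist ?\<Omega> (T D1 D2 f g) (dbar2 \<phi>) = regular_dist ?\<Omega> (snd f) \<phi>"
        unfolding borel_version_regular_dist[OF vu tm(3)[OF \<phi>]] borel_version_regular_dist[OF v2 tm(1)[OF \<phi>]] o
        unfolding u_def
        by (rule weak_dbar2_cauchy_potential[OF D(1) R(2) i1(2) z(1) i2(2) z(2) ig(2) z(3) weak1 \<phi>])
    qed
    show "Lp_norm ?\<Omega> p (T D1 D2 f g) \<le> 9 * M * B_norm ?\<Omega> p f g"
    proof -
      let ?N = "\<lambda>h::C2 \<Rightarrow> complex. LINT z|lborel. norm (h z) powr p"
      have N0: "0 \<le> ?N h" for h by (auto intro!: integral_nonneg_AE)
      have p1: "0 \<le> 1 / p" "p \<noteq> 0" using assms(3) by auto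
      have "(LINT z:?\<Omega>|lebesgue. norm (T D1 D2 f g z) powr p) = ?N u'"
        using T_int(3) by (simp add: set_lebesgue_integral_def)
      also have "\<dots> \<le> ?N u"
        by (intro integral_mono u'int uLp) (auto simp: u'_def indicator_def)
      also have "\<dots> \<le> (3 * M) powr p * (?N f1 + ?N f2 + ?N g')" by (rule uLp(2))
      finally have "Lp_norm ?\<Omega> p (T D1 D2 f g) \<le> ((3 * M) powr p * (?N f1 + ?N f2 + ?N g')) powr (1 / p)"
        unfolding Lp_norm_def using p1
        by (intro powr_mono2) (auto simp: set_lebesgue_integral_def intro!: integral_nonneg_AE)
      also have "\<dots> = 3 * M * (?N f1 + ?N f2 + ?N g') powr (1 / p)"
        using M N0 p1 by (simp add: powr_mult powr_powr)
      also have "\<dots> \<le> 3 * M * (3 powr (1 / p) * (?N f1 powr (1 / p) + ?N f2 powr (1 / p) + ?N g' powr (1 / p)))"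
        using M N0 p1 by (intro mult_left_mono powr_sum3_le) auto
      also have "\<dots> \<le> 3 * M * (3 * (?N f1 powr (1 / p) + ?N f2 powr (1 / p) + ?N g' powr (1 / p)))"
      proof -
        have "(3::real) powr (1 / p) \<le> 3 powr 1" using assms(3) by (intro powr_mono) auto
        then show ?thesis using M by (intro mult_left_mono mult_right_mono) auto
      qed
      also have "\<dots> = 9 * M * B_norm ?\<Omega> p f g"
        unfolding B_norm_def Lp_norm_def i1(3) i2(3) ig(3) by simp
      finally show ?thesis .
    qed
  qed
qed

end
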